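(* For every $\epsilon>0$ there exists $M(\epsilon)$ such that for all integers $n\ge M(\epsilon)$, \[ -n\, W_{-1}\!\left(-\frac{e^{1-\epsilon}}{n}\right) > p_n > -(n-1)\, W_{-1}\!\left(-\frac{e^{1+\epsilon}}{n-1}\right). \]
   Context: $p_n$ denotes the $n$-th prime. $W_{-1}$ denotes the lower real branch of the Lambert $W$ function: for $y\in[-1/e,0)$, $W_{-1}(y)$ is the unique real solution $w\le -1$ of $w e^{w}=y$. *)

theory Defs
  imports "HOL-Analysis.Analysis" "HOL-Computational_Algebra.Primes" "HOL-Library.Infinite_Set"
begin

text \<open>
  The indexing is 1-based, so \<open>nth_prime 1 = 2\<close>, whereas \<^const>\<open>enumerate\<close> counts from 0.
  The value at 0 is junk (also 2).
\<close>
definition nth_prime :: "nat \<Rightarrow> nat" where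
  "nth_prime n = enumerate {p. prime p} (n - 1)"

text \<open>Only meaningful for \<open>- exp (-1) \<le> y < 0\<close>; see \<open>lambert_Wm1_unique\<close> below.\<close>
definition lambert_Wm1 :: "real \<Rightarrow> real" where
  "lambert_Wm1 y = (THE w. w \<le> -1 \<and> w * exp w = y)"

lemma nth_prime_1: "nth_prime 1 = 2"
proof -
  have "(LEAST p::nat. prime p) = 2"
    by (rule Least_equality) (auto dest: prime_ge_2_nat)
  thus ?thesis by (simp add: nth_prime_def enumerate_0)
qed

lemma nth_prime_Suc:
  assumes "n \<ge> 1"
  shows "nth_prime (Suc n) = (LEAST p. prime p \<and> p > nth_prime n)"
proof -
  obtain m where "n = Suc m" using assms by (cases n) auto
  thus ?thesis
    using enumerate_Suc''[OF primes_infinite, of m] by (simp add: nth_prime_def)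
qed

lemma x_exp_strict_antimono:
  fixes a b :: real
  assumes "a < b" "b \<le> -1"
  shows "b * exp b < a * exp a"
proof (rule DERIV_neg_imp_decreasing_open[OF assms(1), of "\<lambda>w. w * exp w"])
  fix x assume x: "a < x" "x < b"
  have "((\<lambda>w. w * exp w) has_real_derivative (1 + x) * exp x) (at x)"
    by (auto intro!: derivative_eq_intros simp: algebra_simps)
  moreover have "(1 + x) * exp x < 0"
    using x assms by (intro mult_neg_pos) auto
  ultimately show "\<exists>y. ((\<lambda>w. w * exp w) has_real_derivative y) (at x) \<and> y < 0" by blast
qed (auto intro!: continuous_intros)

lemma lambert_Wm1_unique:
  fixes y :: real
  assumes "- exp (-1) \<le> y" "y < 0"
  shows "\<exists>!w. w \<le> -1 \<and> w * exp w = y"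
proof -
  have "((\<lambda>w::real. w * exp w) \<longlongrightarrow> 0) at_bot"
    using tendsto_minus[OF tendsto_power_div_exp_0[of 1]]
    by (simp add: filterlim_at_bot_mirror exp_minus field_simps)
  hence "eventually (\<lambda>w::real. w * exp w > y) at_bot"
    using assms(2) by (rule order_tendstoD)
  then obtain a where a: "\<And>w. w \<le> a \<Longrightarrow> w * exp w > y"
    unfolding eventually_at_bot_linorder by blast
  define c where "c = min a (-1)"
  have "\<exists>x. c \<le> x \<and> x \<le> -1 \<and> x * exp x = y"
    using a[of c] assms(1)
    by (intro IVT2') (auto simp: c_def intro!: continuous_intros)
  moreover have "w = w'" if "w \<le> -1" "w' \<le> -1" "w * exp w = w' * exp w'" for w w' :: real
    using x_exp_strict_antimono[of w w'] x_exp_strict_antimono[of w' w] that by linarith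
  ultimately show ?thesis by metis
qed

lemma lambert_Wm1:
  assumes "- exp (-1) \<le> y" "y < 0"
  shows "lambert_Wm1 y \<le> -1" "lambert_Wm1 y * exp (lambert_Wm1 y) = y"
  using theI'[OF lambert_Wm1_unique[OF assms]] by (auto simp: lambert_Wm1_def)

end

theory Submission
  imports
    Defs
    "HOL-Complex_Analysis.Complex_Analysis"
    "HOL-Number_Theory.Prime_Powers"
    "HOL-Real_Asymp.Real_Asymp"
begin

text \<open>
  By the definition of the Lambert function, the claim is equivalent to
  \<open>\<pi>(x) = x / (ln x - 1 + o(1))\<close> at \<open>x = p\<^sub>n\<close>, hence a consequence of the prime number theorem in the form
  \<open>\<pi>(x) = x / ln x + x / ln\<^sup>2 x + O(x / ln\<^sup>3 x)\<close>.

  The latter is obtained by a quantitative version of Newman's contour argument. Put \<open>Z(s) = (s - 1) \<zeta>(s)\<close>.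
  For \<open>\<sigma>\<close> near \<open>1\<close> and \<open>t = Im s\<close> large, \<open>Z(s) = O(|t| powr (21/20))\<close>; by Cauchy's inequality the same holds
  for \<open>Z'\<close>, and the inequality \<open>3 + 4 cos \<phi> + cos 2\<phi> \<ge> 0\<close> yields a lower bound for \<open>|Z|\<close> just right of the
  line \<open>Re s = 1\<close>. Together, these give a zero-free region of width \<open>\<kappa> |t| powr (-1/4)\<close> left of that line in
  which \<open>\<zeta>'/\<zeta>\<close> is \<open>O(|t| powr (1/4))\<close>. Taking the radius of the contour for \<open>\<Sum>n\<le>N. (\<Lambda>(n) - 1) / n\<close> to be
  \<open>ln\<^sup>3 N\<close> shows that this sum is \<open>c + O(1 / ln\<^sup>2 N)\<close>, and summation by parts does the rest.
\<close>

section \<open>The function \<open>(s - 1) \<zeta>(s)\<close>\<close>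

text \<open>The exponents come from two requirements. Suppose Z(s) = O(|t|^(1+a)) near the line. At
  distance \<eta> = |t|^(-b) to the right of it, the inequality with weights 3, 4, 1 gives |Z| at
  least of order |t|^(1 - (3b+a)/4), while crossing to the left costs at most \<eta> times the bound
  for Z', that is |t|^(1+a-b). The two orders agree exactly for b = 5a, and then \<zeta>'/\<zeta> =
  O(|t|^b). In the contour argument with T = ln N, the half circles contribute T / R, so an error 1
  / T^2 calls for R = T^3; the vertical side left of the line carries a factor exp(-const T R^(-b)),
  which beats all powers of T only if 3b < 1. The choice a = 1/20, b = 1/4 meets both, and a = 1/20
  is what trivial estimates give for Re s \<ge> 19/20. The error 1 / T^2 then becomes N / ln^2 N for
  \<psi>(N) - N and N / ln^3 N for the prime count, which is below the term N / ln^2 N that produces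
  the -1 in ln x - 1.\<close>

lemma norm_of_nat_powr: "norm (of_nat n powr s :: complex) = real n powr Re s"
  by (subst norm_powr_real_powr) auto

lemma holomorphic_of_nat_powr [holomorphic_intros]:
  assumes "f holomorphic_on A"
  shows   "(\<lambda>s. of_nat n powr f s :: complex) holomorphic_on A"
  by (cases "n = 0") (use assms in \<open>auto intro!: holomorphic_intros\<close>)

lemma has_field_derivative_of_nat_powr:
  "((\<lambda>s::complex. of_nat n powr (-s)) has_field_derivative - of_real (ln (real n)) * of_nat n powr (-s)) (at s)"
proof (cases "n = 0")
  case False
  thus ?thesis
    by (auto intro!: derivative_eq_intros simp: powr_def Ln_of_nat)
qed auto

lemma summable_nat_powr: "\<sigma> > 1 \<Longrightarrow> summable (\<lambda>n. real n powr (-\<sigma>))"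
  by (subst summable_real_powr_iff) auto

text \<open>
  The terms of a telescoping series for \<open>(s - 1) * \<zeta>(s)\<close>: for \<open>n > 0\<close>, \<open>zreg_term n s\<close> is \<open>s - 1\<close> times the
  integral of \<open>n powr (-s) - x powr (-s)\<close> over \<open>n \<le> x \<le> n + 1\<close>, so the series converges for \<open>Re s > 0\<close>.
  As \<open>0 powr z = 0\<close>, the term for \<open>n = 0\<close> is \<open>1\<close>.
\<close>
definition zreg_term :: "nat \<Rightarrow> complex \<Rightarrow> complex" where
  "zreg_term n s = (s - 1) * of_nat n powr (-s) + of_nat (Suc n) powr (1 - s) - of_nat n powr (1 - s)"

lemma sum_zreg_term:
  "(\<Sum>n<N. zreg_term n s) = (s - 1) * (\<Sum>n<N. of_nat n powr (-s)) + of_nat N powr (1 - s)"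
  by (induction N) (simp_all add: zreg_term_def algebra_simps)

text \<open>The map w \<mapsto> (s - 1) n^(-s) w + w^(1-s) has derivative (s - 1) (n^(-s) - w^(-s)),
  and its increment from n to n + 1 is exactly the term. The mean value inequality is used twice:
  for this increment, and for the derivative itself, where it yields the decay |s| n^(-Re s -
  1).\<close>

lemma norm_zreg_term_le:
  assumes "n > 0" "Re s > 0"
  shows   "norm (zreg_term n s) \<le> norm (s - 1) * norm s * real n powr (-Re s - 1)"
proof -
  define S where "S = closed_segment (of_nat n) (of_nat (Suc n) :: complex)"
  have S: "convex S" "of_nat n \<in> S" "of_nat (Suc n) \<in> S" by (auto simp: S_def)
  have S_real: "\<exists>x. w = of_real x \<and> real n \<le> x \<and> x \<le> real n + 1" if "w \<in> S" for w
  proof -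
    have "w \<in> closed_segment (complex_of_real (real n)) (complex_of_real (real n + 1))"
      using that by (simp add: S_def add_ac)
    thus ?thesis
      unfolding closed_segment_of_real by (auto simp: closed_segment_eq_real_ivl)
  qed
  have dpow: "((\<lambda>w. w powr c) has_field_derivative c * w powr (c - 1)) (at w within S)" if "w \<in> S" for c w
  proof -
    from S_real[OF that] obtain x where "w = of_real x" "x > 0" using assms by auto
    thus ?thesis
      by (auto intro!: derivative_eq_intros simp: complex_nonpos_Reals_iff)
  qed
  define B where "B = norm s * real n powr (-Re s - 1)"
  have *: "norm (of_nat n powr (-s) - w powr (-s)) \<le> B" if "w \<in> S" for w
  proof -
    have "norm (of_nat n powr (-s) - w powr (-s)) \<le> B * norm (of_nat n - w)"
    proof (rule field_differentiable_bound[OF S(1)])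
      fix z assume z: "z \<in> S"
      show "((\<lambda>w. w powr (-s)) has_field_derivative (-s) * z powr (-s - 1)) (at z within S)"
        using dpow[OF z, of "-s"] by simp
      from S_real[OF z] obtain x where x: "z = of_real x" "x \<ge> real n" by auto
      show "norm ((-s) * z powr (-s-1)) \<le> B"
        using x assms by (auto simp: norm_mult norm_powr_real_powr B_def intro!: mult_left_mono powr_mono2')
    qed (use S that in auto)
    also have "\<dots> \<le> B * 1"
    proof (rule mult_left_mono)
      from S_real[OF that] obtain x where x: "w = of_real x" "x \<ge> real n" "x \<le> real n + 1" by auto
      have "norm (of_nat n - w) = norm (complex_of_real (real n - x))" by (simp add: x)
      also have "\<dots> \<le> 1" using x by (subst norm_of_real) auto
      finally show "norm (of_nat n - w) \<le> 1" .
    qed (auto simp: B_def)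
    finally show ?thesis by simp
  qed
  have "norm (((s - 1) * of_nat n powr (-s) * of_nat (Suc n) + of_nat (Suc n) powr (1 - s)) -
              ((s - 1) * of_nat n powr (-s) * of_nat n + of_nat n powr (1 - s)))
         \<le> (norm (s - 1) * B) * norm (of_nat (Suc n) - of_nat n :: complex)"
  proof (rule field_differentiable_bound[OF S(1)])
    fix z assume z: "z \<in> S"
    show "((\<lambda>w. (s - 1) * of_nat n powr (-s) * w + w powr (1 - s)) has_field_derivative
             (s - 1) * (of_nat n powr (-s) - z powr (-s))) (at z within S)"
      by (rule derivative_eq_intros refl dpow z)+ (simp add: algebra_simps)
    show "norm ((s - 1) * (of_nat n powr (-s) - z powr (-s))) \<le> norm (s - 1) * B"
      unfolding norm_mult by (intro mult_left_mono *[OF z]) auto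
  qed (use S in auto)
  thus ?thesis by (simp add: zreg_term_def B_def algebra_simps)
qed

definition zreg :: "complex \<Rightarrow> complex" where
  "zreg s = (\<Sum>n. zreg_term n s)"

text \<open>This is the hypothesis of \<open>series_and_derivative_comparison_local\<close>: on the
  ball of radius Re s / 2 real parts stay at least Re s / 2, so one convergent series dominates all
  terms.\<close>

lemma zreg_local_comparison:
  assumes "Re s > 0"
  shows "\<exists>d h. 0 < d \<and> summable h \<and>
           (\<forall>\<^sub>F n in sequentially. \<forall>y\<in>ball s d \<inter> {s. Re s > 0}. norm (zreg_term n y) \<le> (h n :: real))"
proof (intro exI conjI)
  define K where "K = norm s + Re s + 1"
  show "0 < Re s / 2" using assms by simp
  show "summable (\<lambda>n. K * K * real n powr (-(Re s / 2 + 1)))"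
    by (intro summable_mult summable_nat_powr) (use assms in auto)
  show "\<forall>\<^sub>F n in sequentially. \<forall>y\<in>ball s (Re s / 2) \<inter> {s. Re s > 0}.
          norm (zreg_term n y) \<le> K * K * real n powr (-(Re s / 2 + 1))"
    using eventually_gt_at_top[of 0]
  proof eventually_elim
    case (elim n)
    show ?case
    proof
      fix y assume y: "y \<in> ball s (Re s / 2) \<inter> {s. Re s > 0}"
      have ys: "norm (y - s) \<le> Re s / 2" using y by (auto simp: dist_norm norm_minus_commute)
      have "norm y \<le> norm s + norm (y - s)" by norm
      hence 1: "norm y \<le> K" using ys assms by (auto simp: K_def)
      have "norm (y - 1) \<le> norm s + norm (y - s) + norm (1::complex)" by norm
      hence 2: "norm (y - 1) \<le> K" using ys assms by (auto simp: K_def)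
      have "\<bar>Re (y - s)\<bar> \<le> Re s / 2" using abs_Re_le_cmod[of "y - s"] ys by linarith
      hence 3: "Re y \<ge> Re s / 2" unfolding minus_complex.sel by linarith
      have "norm (zreg_term n y) \<le> norm (y - 1) * norm y * real n powr (-Re y - 1)"
        using y elim by (intro norm_zreg_term_le) auto
      also have "\<dots> \<le> K * K * real n powr (-(Re s / 2 + 1))"
        using 1 2 3 elim assms by (intro mult_mono powr_mono) (auto simp: K_def)
      finally show "norm (zreg_term n y) \<le> K * K * real n powr (-(Re s / 2 + 1))" .
    qed
  qed
qed

lemma zreg_term_has_deriv: 
  "(zreg_term n has_field_derivative deriv (zreg_term n) s) (at s)"
proof -
  have "zreg_term n holomorphic_on UNIV"
    unfolding zreg_term_def by (intro holomorphic_intros)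
  thus ?thesis by (intro holomorphic_derivI[of _ UNIV]) auto
qed

lemma
  shows sums_zreg: "Re s > 0 \<Longrightarrow> (\<lambda>n. zreg_term n s) sums zreg s"
    and holomorphic_zreg_aux: "zreg holomorphic_on {s. Re s > 0}"
proof -
  obtain g g' where g: "\<And>x. Re x > 0 \<Longrightarrow>
     (\<lambda>n. zreg_term n x) sums g x \<and> (\<lambda>n. deriv (zreg_term n) x) sums g' x \<and> (g has_field_derivative g' x) (at x)"
    using series_and_derivative_comparison_local[of "{s. Re s > 0}" zreg_term
             "\<lambda>n. deriv (zreg_term n)", OF open_halfspace_Re_gt zreg_term_has_deriv zreg_local_comparison]
    by auto
  have eq: "g x = zreg x" if "Re x > 0" for x
    using g[OF that] by (auto simp: zreg_def sums_iff)
  show "(\<lambda>n. zreg_term n s) sums zreg s" if "Re s > 0" for s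
    using g[OF that] eq[OF that] by simp
  have "g holomorphic_on {s. Re s > 0}"
    using g open_halfspace_Re_gt by (subst holomorphic_on_open) auto
  thus "zreg holomorphic_on {s. Re s > 0}"
    by (rule holomorphic_transform) (auto simp: eq)
qed

lemma holomorphic_zreg: "(\<And>s. s \<in> A \<Longrightarrow> Re s > 0) \<Longrightarrow> zreg holomorphic_on A"
  by (rule holomorphic_on_subset[OF holomorphic_zreg_aux]) auto

lemma isCont_zreg: "Re s > 0 \<Longrightarrow> isCont zreg s"
  using holomorphic_on_imp_continuous_on[OF holomorphic_zreg_aux] open_halfspace_Re_gt[of 0]
  by (simp add: continuous_on_eq_continuous_at)

text \<open>The residue of \<zeta> at 1. All terms with n > 0 vanish at s = 1, and n = 0 contributes
  \<open>1 powr 0 - 0 powr 0\<close>, where \<open>0 powr 0\<close> is 0.\<close>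

lemma zreg_1 [simp]: "zreg 1 = 1"
proof -
  have "zreg_term n 1 = (if n = 0 then 1 else 0)" for n
    by (cases "n = 0") (simp_all add: zreg_term_def del: of_nat_Suc)
  hence "zreg 1 = (\<Sum>n. if n = 0 then 1 else 0)" by (simp add: zreg_def)
  also have "\<dots> = 1" using sums_single[of 0 "\<lambda>_. 1::complex"] by (simp add: sums_iff)
  finally show ?thesis .
qed

lemma summable_dirichlet:
  fixes a :: "nat \<Rightarrow> complex"
  assumes "\<And>n. norm (a n) \<le> 1" "Re s > 1"
  shows   "summable (\<lambda>n. norm (a n * of_nat n powr (-s)))"
proof (rule summable_comparison_test[OF _ summable_nat_powr[OF assms(2)]], intro exI allI impI)
  fix n
  show "norm (norm (a n * of_nat n powr (-s))) \<le> real n powr (-Re s)"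
    using mult_right_mono[OF assms(1)[of n], of "real n powr (-Re s)"]
    by (simp add: norm_mult norm_of_nat_powr)
qed

lemma zreg_eq_zeta:
  assumes "Re s > 1"
  shows   "zreg s = (s - 1) * (\<Sum>n. of_nat n powr (-s))"
proof -
  have "(\<lambda>N. norm (of_nat N powr (1 - s) :: complex)) \<longlonglongrightarrow> 0"
    unfolding norm_of_nat_powr
    using tendsto_neg_powr[of "1 - Re s", OF _ filterlim_real_sequentially] assms by simp
  hence "(\<lambda>N. of_nat N powr (1 - s) :: complex) \<longlonglongrightarrow> 0"
    by (simp only: tendsto_norm_zero_iff)
  moreover have "(\<lambda>N. \<Sum>n<N. of_nat n powr (-s) :: complex) \<longlonglongrightarrow> (\<Sum>n. of_nat n powr (-s))"
    using summable_norm_cancel[OF summable_dirichlet[of "\<lambda>_. 1" s]] assms by (intro summable_LIMSEQ) auto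
  ultimately have "(\<lambda>N. \<Sum>n<N. zreg_term n s) \<longlonglongrightarrow> (s - 1) * (\<Sum>n. of_nat n powr (-s)) + 0"
    unfolding sum_zreg_term by (intro tendsto_intros)
  moreover have "(\<lambda>N. \<Sum>n<N. zreg_term n s) \<longlonglongrightarrow> zreg s"
    using sums_zreg[of s] assms by (auto simp: sums_def)
  ultimately show ?thesis using LIMSEQ_unique by fastforce
qed

section \<open>Growth of \<open>zreg\<close> and its derivative near the line Re s = 1\<close>

lemma sum_le_antiderivative:
  fixes h \<phi> :: "real \<Rightarrow> real"
  assumes "\<And>x. x \<ge> real N \<Longrightarrow> (\<phi> has_real_derivative - h x) (at x)"
  assumes "\<And>x y. real N \<le> x \<Longrightarrow> x \<le> y \<Longrightarrow> h y \<le> h x" "M \<ge> N"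
  shows   "(\<Sum>n\<in>{N<..M}. h (real n)) \<le> \<phi> (real N) - \<phi> (real M)"
  using \<open>M \<ge> N\<close>
proof (induction M rule: dec_induct)
  case (step M)
  have "\<exists>z. real M < z \<and> z < real M + 1 \<and> \<phi> (real M + 1) - \<phi> (real M) = (real M + 1 - real M) * (- h z)"
    using step by (intro MVT2 assms) auto
  then obtain z where z: "real M < z" "z < real M + 1" "\<phi> (real M + 1) - \<phi> (real M) = - h z" by auto
  have "h (real M + 1) \<le> h z" using z step by (intro assms) auto
  moreover have "{N<..Suc M} = insert (Suc M) {N<..M}" using step by auto
  ultimately show ?case using step.IH z by (simp add: add_ac)
qed auto

lemma sum_powr_le:
  assumes "0 < y" "y \<le> 1"
  shows   "(\<Sum>n\<le>N. real n powr (y - 1)) \<le> real N powr y / y"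
proof (induction N)
  case (Suc N)
  have "real (Suc N) powr (y - 1) \<le> (real (Suc N) powr y - real N powr y) / y"
  proof (cases "N = 0")
    case False
    have "\<exists>z. real N < z \<and> z < real N + 1 \<and> (real N + 1) powr y - real N powr y =
            (real N + 1 - real N) * (y * z powr (y - 1))"
      using assms False by (intro MVT2) (auto intro!: derivative_eq_intros)
    then obtain z where z: "real N < z" "z < real N + 1"
      "(real N + 1) powr y - real N powr y = y * z powr (y - 1)" by auto
    have "(real N + 1) powr (y - 1) \<le> z powr (y - 1)"
      using z assms False by (intro powr_mono2') auto
    thus ?thesis using z assms by (simp add: field_simps)
  qed (use assms in auto)
  with Suc show ?case by (simp add: diff_divide_distrib)
qed (use assms in auto)

text \<open>Cutting the series at N of size t = |Im s| balances both parts: the closed form of the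
  initial sum costs |s - 1| N^(1/20), the tail |s - 1| |s| N^(-19/20), and both are of order
  t^(21/20). The constant 158 is 120 + 2 + 36, from the initial sum, the boundary term N^(1-s) and
  the tail.\<close>

lemma norm_zreg_le:
  assumes s: "19/20 \<le> Re s" "Re s \<le> 3" "\<bar>Im s\<bar> \<ge> 1"
  shows   "norm (zreg s) \<le> 158 * \<bar>Im s\<bar> powr (21/20)"
proof -
  define t where "t = \<bar>Im s\<bar>"
  define N where "N = nat \<lceil>t\<rceil>"
  have t: "t \<ge> 1" using s by (simp add: t_def)
  have N: "real N \<ge> t" "real N \<le> 2 * t" "N > 0"
    using t by (auto simp: N_def) linarith+
  have norm_s: "norm s \<le> 4 * t" using cmod_le[of s] s t by (simp add: t_def)
  have norm_s1: "norm (s - 1) \<le> 3 * t" using cmod_le[of "s - 1"] s t by (simp add: t_def)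
  have pow1: "real n powr (-Re s) \<le> real n powr (1/20 - 1)" for n
    using s by (cases "n = 0") (auto intro!: powr_mono)
  have "real N powr (1/20) \<le> (2 * t) powr (1/20)" using N by (intro powr_mono2) auto
  also have "\<dots> = 2 powr (1/20) * t powr (1/20)" using t by (simp add: powr_mult)
  also have "\<dots> \<le> 2 powr 1 * t powr (1/20)" by (intro mult_right_mono powr_mono) auto
  finally have N20: "real N powr (1/20) \<le> 2 * t powr (1/20)" by simp
  have tt: "t * t powr (1/20) = t powr (21/20)" using t by (simp flip: powr_add powr_one' add: powr_mult_base)
  have tt2: "t * t * t powr (-19/20) = t powr (21/20)"
    using t by (simp add: powr_mult_base mult.assoc)
  have "norm (\<Sum>n<M. zreg_term n s) \<le> 158 * t powr (21/20)" if "M \<ge> N" for M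
  proof -
    have "(\<Sum>n<M. zreg_term n s) = (\<Sum>n<N. zreg_term n s) + (\<Sum>n=N..<M. zreg_term n s)"
      using that by (subst sum.union_disjoint [symmetric]) (auto intro!: sum.cong)
    also have "norm \<dots> \<le> norm ((s - 1) * (\<Sum>n<N. of_nat n powr (-s))) + norm (of_nat N powr (1 - s) :: complex) +
                   norm (\<Sum>n=N..<M. zreg_term n s)"
      unfolding sum_zreg_term by norm
    also have "norm ((s - 1) * (\<Sum>n<N. of_nat n powr (-s))) \<le> (3 * t) * (20 * (2 * t powr (1/20)))"
      unfolding norm_mult
    proof (rule mult_mono[OF norm_s1])
      have "norm (\<Sum>n<N. of_nat n powr (-s) :: complex) \<le> (\<Sum>n<N. real n powr (-Re s))"
        by (rule order.trans[OF norm_sum]) (simp add: norm_of_nat_powr)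
      also have "\<dots> \<le> (\<Sum>n\<le>N. real n powr (1/20 - 1))"
        by (rule order.trans[OF sum_mono sum_mono2]) (use pow1 in auto)
      also have "\<dots> \<le> real N powr (1/20) / (1/20)" by (intro sum_powr_le) auto
      also have "\<dots> \<le> 20 * (2 * t powr (1/20))" using N20 by simp
      finally show "norm (\<Sum>n<N. of_nat n powr (-s) :: complex) \<le> \<dots>" .
    qed (use t in auto)
    also have "\<dots> = 120 * t powr (21/20)" by (simp flip: tt)
    also have "norm (of_nat N powr (1 - s) :: complex) \<le> real N powr (1/20)"
      unfolding norm_of_nat_powr using s N by (intro powr_mono) auto
    also have "\<dots> \<le> 2 * t powr (1/20)" by (fact N20)
    also have "2 * t powr (1/20) \<le> 2 * t powr (21/20)" using t by (intro mult_left_mono powr_mono) auto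
    also have "norm (\<Sum>n=N..<M. zreg_term n s) \<le> (\<Sum>n=N..<M. 12 * t * t * real n powr (-39/20))"
    proof (rule sum_norm_le)
      fix n assume n: "n \<in> {N..<M}"
      have "norm (zreg_term n s) \<le> norm (s - 1) * norm s * real n powr (-Re s - 1)"
        using n N s by (intro norm_zreg_term_le) auto
      also have "\<dots> \<le> (3 * t) * (4 * t) * real n powr (-39/20)"
        using s N n norm_s norm_s1 t by (intro mult_mono powr_mono) auto
      finally show "norm (zreg_term n s) \<le> 12 * t * t * real n powr (-39/20)" by simp
    qed
    also have "\<dots> = 12 * t * t * (\<Sum>n=N..<M. real n powr (-39/20))" by (simp add: sum_distrib_left)
    also have "(\<Sum>n=N..<M. real n powr (-39/20)) \<le> (\<Sum>n\<in>insert N {N<..M}. real n powr (-39/20))"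
      by (intro sum_mono2) auto
    also have "\<dots> = real N powr (-39/20) + (\<Sum>n\<in>{N<..M}. real n powr (-39/20))" by simp
    also have "real N powr (-39/20) \<le> real N powr (-19/20)" using N by (intro powr_mono) auto
    also have "(\<Sum>n\<in>{N<..M}. real n powr (-39/20)) \<le>
        20/19 * real N powr (-19/20) - 20/19 * real M powr (-19/20)"
      using N that by (intro sum_le_antiderivative) (auto intro!: derivative_eq_intros powr_mono2')
    also have "real N powr (-19/20) + (20/19 * real N powr (-19/20) - 20/19 * real M powr (-19/20))
        \<le> 3 * real N powr (-19/20)"
      using powr_ge_zero[of "real N" "-19/20"] powr_ge_zero[of "real M" "-19/20"] by linarith
    also have "real N powr (-19/20) \<le> t powr (-19/20)" using N t by (intro powr_mono2') auto
    also have "12 * t * t * (3 * t powr (-19/20)) = 36 * t powr (21/20)" by (simp flip: tt2)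
    finally show ?thesis using t by simp
  qed
  hence "norm (zreg s) \<le> 158 * t powr (21/20)"
    using sums_zreg[of s] s unfolding sums_def
    by (intro LIMSEQ_le_const2[OF tendsto_norm]) auto
  thus ?thesis by (simp add: t_def)
qed

text \<open>Cauchy's inequality on circles of radius 1/40. They stay in the strip of
  \<open>norm_zreg_le\<close> because 39/40 - 1/40 = 19/20, and on them the imaginary part at most
  doubles.\<close>

lemma norm_deriv_zreg_le:
  "\<exists>C>0. \<forall>s. 39/40 \<le> Re s \<longrightarrow> Re s \<le> 2 \<longrightarrow> \<bar>Im s\<bar> \<ge> 2 \<longrightarrow> 
         norm (deriv zreg s) \<le> C * \<bar>Im s\<bar> powr (21/20)"
proof (intro exI[of _ "158 * 2 powr (21/20) * 40"] conjI allI impI)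
  fix s assume s: "39/40 \<le> Re s" "Re s \<le> 2" "\<bar>Im s\<bar> \<ge> 2"
  have near: "\<bar>Re x - Re s\<bar> \<le> 1/40 \<and> \<bar>Im x - Im s\<bar> \<le> 1/40" if "norm (s - x) \<le> 1/40" for x
    using abs_Re_le_cmod[of "s - x"] abs_Im_le_cmod[of "s - x"] that unfolding minus_complex.sel by linarith
  have pos: "Re x > 0" if "norm (s - x) \<le> 1/40" for x using near[OF that] s by linarith
  have "norm ((deriv ^^ 1) zreg s) \<le> fact 1 * (158 * (2 powr (21/20) * \<bar>Im s\<bar> powr (21/20))) / (1/40) ^ 1"
  proof (rule Cauchy_inequality)
    show "zreg holomorphic_on ball s (1/40)"
      by (intro holomorphic_zreg) (auto simp: dist_norm intro!: pos)
    show "continuous_on (cball s (1/40)) zreg"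
      by (intro holomorphic_on_imp_continuous_on holomorphic_zreg) (auto simp: dist_norm intro!: pos)
    fix x assume x: "norm (s - x) = 1/40"
    have "norm (zreg x) \<le> 158 * \<bar>Im x\<bar> powr (21/20)"
      using near[of x] x s by (intro norm_zreg_le) linarith+
    also have "\<bar>Im x\<bar> powr (21/20) \<le> (2 * \<bar>Im s\<bar>) powr (21/20)"
    proof (rule powr_mono2)
      show "\<bar>Im x\<bar> \<le> 2 * \<bar>Im s\<bar>" using near[of x] x s by linarith
    qed auto
    also have "\<dots> = 2 powr (21/20) * \<bar>Im s\<bar> powr (21/20)" by (simp add: powr_mult)
    finally show "norm (zreg x) \<le> 158 * (2 powr (21/20) * \<bar>Im s\<bar> powr (21/20))" by simp
  qed auto
  thus "norm (deriv zreg s) \<le> 158 * 2 powr (21/20) * 40 * \<bar>Im s\<bar> powr (21/20)" by simp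
qed auto

section \<open>Dirichlet series\<close>

lemma dirichlet_local_comparison:
  fixes a :: "nat \<Rightarrow> complex"
  assumes a: "\<And>n. norm (a n) \<le> 1" and s: "Re s > 1"
  shows "\<exists>d h. 0 < d \<and> summable h \<and>
           (\<forall>\<^sub>F n in sequentially. \<forall>y\<in>ball s d \<inter> {s. Re s > 1}. norm (a n * of_nat n powr (-y)) \<le> (h n :: real))"
proof (intro exI conjI)
  define \<sigma> where "\<sigma> = (Re s + 1) / 2"
  have \<sigma>: "\<sigma> > 1" using s by (simp add: \<sigma>_def)
  show "(Re s - 1) / 2 > 0" using s by simp
  show "summable (\<lambda>n. real n powr (-\<sigma>))" by (intro summable_nat_powr \<sigma>)
  show "\<forall>\<^sub>F n in sequentially. \<forall>y\<in>ball s ((Re s - 1) / 2) \<inter> {s. Re s > 1}.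
          norm (a n * of_nat n powr (-y)) \<le> real n powr (-\<sigma>)"
    using eventually_gt_at_top[of 0]
  proof eventually_elim
    case (elim n)
    show ?case
    proof
      fix y assume y: "y \<in> ball s ((Re s - 1) / 2) \<inter> {s. Re s > 1}"
      have "Re (s - y) < (Re s - 1) / 2"
        using complex_Re_le_cmod[of "s - y"] y by (auto simp: dist_norm)
      hence "Re y \<ge> \<sigma>" by (simp add: \<sigma>_def field_simps)
      hence "norm (a n * of_nat n powr (-y)) \<le> 1 * real n powr (-\<sigma>)"
        unfolding norm_mult norm_of_nat_powr using elim a by (intro mult_mono powr_mono) auto
      thus "norm (a n * of_nat n powr (-y)) \<le> real n powr (-\<sigma>)" by simp
    qed
  qed
qed

text \<open>Coefficients bounded by 1 cover both series that are differentiated later: \<zeta>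
  itself, and its logarithm with coefficients \<Lambda>(n) / ln n. Termwise differentiation comes
  from the same comparison theorem as for \<open>zreg\<close>.\<close>

lemma
  fixes a :: "nat \<Rightarrow> complex"
  assumes a: "\<And>n. norm (a n) \<le> 1" and s: "Re s > 1"
  shows summable_dirichlet_deriv: "summable (\<lambda>n. a n * (- of_real (ln (real n)) * of_nat n powr (-s)))" (is ?th1)
    and has_field_derivative_dirichlet:
      "((\<lambda>s. \<Sum>n. a n * of_nat n powr (-s)) has_field_derivative 
          (\<Sum>n. a n * (- of_real (ln (real n)) * of_nat n powr (-s)))) (at s)" (is ?th2)
proof -
  have "((\<lambda>s. a n * of_nat n powr (-s)) has_field_derivative
          a n * (- of_real (ln (real n)) * of_nat n powr (-x))) (at x)" for n x
    by (intro DERIV_cmult has_field_derivative_of_nat_powr)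
  then obtain g g' where g: "\<And>x. Re x > 1 \<Longrightarrow>
     (\<lambda>n. a n * of_nat n powr (-x)) sums g x \<and> 
     (\<lambda>n. a n * (- of_real (ln (real n)) * of_nat n powr (-x))) sums g' x \<and> (g has_field_derivative g' x) (at x)"
    using series_and_derivative_comparison_local[of "{s. Re s > 1}" "\<lambda>n s. a n * of_nat n powr (-s)"
             "\<lambda>n x. a n * (- of_real (ln (real n)) * of_nat n powr (-x))"] 
          open_halfspace_Re_gt dirichlet_local_comparison[OF a] by fastforce
  show ?th1 using g[OF s] by (auto simp: sums_iff)
  have "g' s = (\<Sum>n. a n * (- of_real (ln (real n)) * of_nat n powr (-s)))"
    using g[OF s] by (auto simp: sums_iff)
  moreover have "(g has_field_derivative g' s) (at s)" using g[OF s] by blast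
  ultimately have "(g has_field_derivative (\<Sum>n. a n * (- of_real (ln (real n)) * of_nat n powr (-s)))) (at s)"
    by simp
  thus ?th2
    by (rule has_field_derivative_transform_within_open[of _ _ _ "{s. Re s > 1}"])
       (use s open_halfspace_Re_gt g in \<open>auto simp: sums_iff\<close>)
qed

text \<open>Read off from the differentiated zeta series at the real point \<sigma>.\<close>

lemma summable_ln_powr:
  assumes "\<sigma> > 1"
  shows   "summable (\<lambda>n. ln (real n) * real n powr (-\<sigma>))"
proof -
  have "summable (\<lambda>n. Re (- (1 * (- of_real (ln (real n)) * of_nat n powr (-complex_of_real \<sigma>)))))"
    using summable_dirichlet_deriv[of "\<lambda>_. 1" "of_real \<sigma>"] assms
    by (intro summable_Re summable_minus) auto
  also have "(\<lambda>n. Re (- (1 * (- of_real (ln (real n)) * of_nat n powr (-complex_of_real \<sigma>))))) =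
             (\<lambda>n. ln (real n) * real n powr (-\<sigma>))"
  proof
    fix n :: nat
    have "of_nat n powr (-complex_of_real \<sigma>) = complex_of_real (real n powr (-\<sigma>))"
      using powr_of_real[of "real n" "-\<sigma>"] by simp
    thus "Re (- (1 * (- of_real (ln (real n)) * of_nat n powr (-complex_of_real \<sigma>)))) = ln (real n) * real n powr (-\<sigma>)"
      by simp
  qed
  finally show ?thesis .
qed

lemma summable_mangoldt:
  assumes "Re s > 1"
  shows   "summable (\<lambda>n. norm (mangoldt n * of_nat n powr (-s) :: complex))"
proof (rule summable_comparison_test[OF _ summable_ln_powr[OF assms]], intro exI allI impI)
  fix n :: nat assume "n \<ge> 1"
  thus "norm (norm (mangoldt n * of_nat n powr (-s) :: complex)) \<le> ln (real n) * real n powr (-Re s)"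
    using mangoldt_le[of n] by (auto simp: norm_mult norm_of_nat_powr abs_mult intro!: mult_right_mono)
qed

lemma of_nat_mult_powr:
  "(of_nat (m * n) :: complex) powr z = of_nat m powr z * of_nat n powr z"
  using powr_times_real[of "of_nat m" "of_nat n" z] by simp

text \<open>The convolution identity that the sum of \<Lambda>(d) over the divisors d of n is ln n:
  the product of two absolutely convergent series is a sum over pairs (d, m), regrouped by n = d
  m.\<close>

lemma mangoldt_times_zeta:
  assumes s: "Re s > 1"
  shows   "(\<Sum>n. mangoldt n * of_nat n powr (-s)) * (\<Sum>n. of_nat n powr (-s)) =
           (\<Sum>n. of_real (ln (real n)) * of_nat n powr (-s) :: complex)"
proof -
  define f g :: "nat \<Rightarrow> complex"
    where "f = (\<lambda>n. mangoldt n * of_nat n powr (-s))" and "g = (\<lambda>n. of_nat n powr (-s))"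
  have f: "summable (\<lambda>n. norm (f n))" using summable_mangoldt[OF s] by (simp add: f_def)
  have g: "summable (\<lambda>n. norm (g n))" using summable_dirichlet[of "\<lambda>_. 1" s] s by (simp add: g_def)
  have f': "(f has_sum suminf f) UNIV" and g': "(g has_sum suminf g) UNIV"
    using f g by (auto intro!: norm_summable_imp_has_sum summable_sums summable_norm_cancel)
  have "(\<lambda>x. norm ((\<lambda>(d,m). f d * g m) x)) summable_on UNIV \<times> UNIV"
    unfolding Infinite_Sum.abs_summable_on_Sigma_iff
  proof (intro conjI ballI)
    fix d show "(\<lambda>m. norm (case (d, m) of (d, m) \<Rightarrow> f d * g m)) summable_on UNIV"
      using g by (auto simp: norm_mult summable_on_UNIV_nonneg_real_iff intro!: summable_mult)
    show "(\<lambda>d. norm (\<Sum>\<^sub>\<infinity>m. norm (case (d, m) of (d, m) \<Rightarrow> f d * g m))) summable_on UNIV"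
      using f by (simp add: norm_mult infsum_cmult_right' summable_on_UNIV_nonneg_real_iff
                      abs_mult infsum_nonneg summable_mult2)
  qed
  from abs_summable_summable[OF this]
  have "((\<lambda>(d,m). f d * g m) has_sum suminf f * suminf g) (UNIV \<times> UNIV)"
    by (intro has_sum_SigmaI[where g = "\<lambda>d. f d * suminf g"])
       (use f' g' in \<open>auto intro!: has_sum_cmult_right has_sum_cmult_left\<close>)
  \<comment> \<open>Index 0 must go before regrouping: every number divides 0, so the pairs with
    product 0 do not correspond to divisors as the others do. Both \<open>f 0\<close> and
    \<open>g 0\<close> are 0.\<close>
  also have "?this \<longleftrightarrow> ((\<lambda>(d,m). f d * g m) has_sum suminf f * suminf g) ({0<..} \<times> {0<..})"
    by (rule has_sum_cong_neutral) (auto simp: f_def g_def)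
  also have "\<dots> \<longleftrightarrow> ((\<lambda>(n,d). mangoldt d * of_nat n powr (-s)) has_sum suminf f * suminf g)
                       (SIGMA n:{0<..}. {d. d dvd n})"
  proof (rule has_sum_reindex_bij_witness[of _ "\<lambda>(n,d). (d, n div d)" "\<lambda>(d,m). (d * m, d)"])
    fix a :: "nat \<times> nat" assume "a \<in> {0<..} \<times> {0<..}"
    thus "(case case a of (d, m) \<Rightarrow> (d * m, d) of (n, d) \<Rightarrow> mangoldt d * of_nat n powr (-s)) =
          (case a of (d, m) \<Rightarrow> f d * g m)"
      by (cases a) (simp add: f_def g_def of_nat_mult_powr del: of_nat_mult)
  qed (auto simp: dvd_div_eq_0_iff intro: Nat.gr0I)
  finally have "((\<lambda>n. of_real (ln (real n)) * of_nat n powr (-s)) has_sum suminf f * suminf g) {0<..}"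
  proof (rule has_sum_SigmaD)
    fix n :: nat assume n: "n \<in> {0<..}"
    have "(\<Sum>d | d dvd n. mangoldt d * of_nat n powr (-s)) = of_real (ln (real n)) * of_nat n powr (-s)"
      using n by (simp add: mangoldt_sum flip: sum_distrib_right)
    moreover have "finite {d. d dvd n}" using n by auto
    ultimately show "((\<lambda>d. case (n, d) of (n, d) \<Rightarrow> mangoldt d * of_nat n powr (-s)) has_sum
            of_real (ln (real n)) * of_nat n powr (-s)) {d. d dvd n}"
      by (intro has_sum_finiteI) auto
  qed
  also have "?this \<longleftrightarrow> ((\<lambda>n. of_real (ln (real n)) * of_nat n powr (-s)) has_sum suminf f * suminf g) UNIV"
    by (rule has_sum_cong_neutral) auto
  finally show ?thesis
    unfolding f_def g_def by (auto dest!: has_sum_imp_sums simp: sums_iff)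
qed

section \<open>The logarithm of \<zeta> and the 3-4-1 inequality\<close>

definition log_zeta :: "complex \<Rightarrow> complex" where
  "log_zeta s = (\<Sum>n. of_real (mangoldt n / ln (real n)) * of_nat n powr (-s))"

text \<open>The coefficient is 1/k at a prime power p^k. For n \<le> 1 numerator and denominator are
  both 0, and the quotient is 0 by convention.\<close>

lemma norm_mangoldt_div_ln_le: "norm (of_real (mangoldt n / ln (real n)) :: complex) \<le> 1"
proof (cases "n \<le> 1")
  case True
  thus ?thesis by (cases "n = 0") (auto simp: le_Suc_eq)
next
  case False
  thus ?thesis
    using mangoldt_le[of n] mangoldt_nonneg[of n] by (auto simp: norm_divide divide_simps simp del: of_real_divide)
qed

text \<open>The value of the constant \<open>c\<close>, which is \<open>1\<close>, does not matter for what follows.\<close>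
lemma zreg_eq_exp_log_zeta:
  "\<exists>c. c \<noteq> 0 \<and> (\<forall>s. Re s > 1 \<longrightarrow> zreg s = (s - 1) * c * exp (log_zeta s))"
proof -
  define \<zeta> where "\<zeta> = (\<lambda>s. \<Sum>n. 1 * of_nat n powr (-s) :: complex)"
  define D where "D = (\<lambda>s. \<Sum>n. mangoldt n * of_nat n powr (-s) :: complex)"
  \<comment> \<open>Both \<zeta> and \<open>exp \<circ> log_zeta\<close> have logarithmic derivative
    -D, so their quotient is constant on the half plane. No branch of the logarithm of \<zeta> has
    to be chosen.\<close>
  have "\<exists>c. \<forall>s\<in>{s. Re s > 1}. \<zeta> s * exp (-log_zeta s) = c"
  proof (rule has_field_derivative_zero_constant)
    show "convex {s. Re s > 1}" by (rule convex_halfspace_Re_gt)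
    fix s assume "s \<in> {s. Re s > 1}"
    hence s: "Re s > 1" by simp
    have "(\<Sum>n. 1 * (- of_real (ln (real n)) * of_nat n powr (-s)) :: complex) = - (\<Sum>n. of_real (ln (real n)) * of_nat n powr (-s))"
      using summable_dirichlet_deriv[of "\<lambda>_. 1" s] s
      by (subst suminf_minus [symmetric]) (auto simp: summable_minus_iff)
    also have "\<dots> = - (D s * \<zeta> s)"
      using mangoldt_times_zeta[OF s] by (simp add: D_def \<zeta>_def)
    finally have 1: "(\<zeta> has_field_derivative - (D s * \<zeta> s)) (at s)"
      unfolding \<zeta>_def using has_field_derivative_dirichlet[of "\<lambda>_. 1" s] s by simp
    have *: "complex_of_real (mangoldt n / ln (real n)) * (- of_real (ln (real n)) * of_nat n powr (-s)) =
             - (mangoldt n * of_nat n powr (-s))" for n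
      by (cases "n \<le> 1") (auto simp: le_Suc_eq)
    have 2: "(log_zeta has_field_derivative - D s) (at s)"
      using has_field_derivative_dirichlet[of "\<lambda>n. of_real (mangoldt n / ln (real n))", OF norm_mangoldt_div_ln_le s]
            summable_norm_cancel[OF summable_mangoldt[OF s]]
      unfolding * by (simp add: log_zeta_def [abs_def] D_def suminf_minus del: of_real_divide)
    show "((\<lambda>s. \<zeta> s * exp (-log_zeta s)) has_field_derivative 0) (at s within {s. Re s > 1})"
      by (rule has_field_derivative_at_within) (auto intro!: derivative_eq_intros 1 2)
  qed
  then obtain c where c: "\<And>s. Re s > 1 \<Longrightarrow> \<zeta> s * exp (-log_zeta s) = c" by auto
  have eq: "zreg s = (s - 1) * c * exp (log_zeta s)" if "Re s > 1" for s
    using zreg_eq_zeta[OF that] c[OF that] by (auto simp: \<zeta>_def exp_minus field_simps)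
  have "c \<noteq> 0"
  proof
    \<comment> \<open>Otherwise \<open>zreg\<close> would vanish right of 1, against
      \<open>zreg 1 = 1\<close> and continuity.\<close>
    assume "c = 0"
    have "isCont zreg 1" by (rule isCont_zreg) simp
    moreover have "(\<lambda>n. 1 + of_real (inverse (real (Suc n))) :: complex) \<longlonglongrightarrow> 1 + of_real 0"
      by (intro tendsto_intros LIMSEQ_inverse_real_of_nat)
    ultimately have "(\<lambda>n. zreg (1 + of_real (inverse (real (Suc n))))) \<longlonglongrightarrow> zreg 1"
      using isCont_tendsto_compose by force
    moreover have "zreg (1 + of_real (inverse (real (Suc n)))) = 0" for n
      using \<open>c = 0\<close> by (subst eq) (auto simp del: of_nat_Suc)
    ultimately show False by (simp add: LIMSEQ_const_iff)
  qed
  with eq show ?thesis by blast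
qed

lemma zreg_nonzero_Re_gt_1: "Re s > 1 \<Longrightarrow> zreg s \<noteq> 0"
  using zreg_eq_exp_log_zeta by (metis exp_not_eq_zero less_irrefl mult_eq_0_iff one_complex.sel(1) right_minus_eq)

text \<open>Holds termwise: the coefficients are nonnegative, and with \<phi> = t ln n one has 3 + 4
  cos \<phi> + cos 2\<phi> = 2 (1 + cos \<phi>)^2.\<close>

lemma Re_log_zeta_341:
  assumes "\<sigma> > 1"
  shows   "3 * Re (log_zeta (of_real \<sigma>)) + 4 * Re (log_zeta (Complex \<sigma> t)) + Re (log_zeta (Complex \<sigma> (2 * t))) \<ge> 0"
proof -
  define b where "b = (\<lambda>n. mangoldt n / ln (real n) * real n powr (-\<sigma>))"
  have b: "b n \<ge> 0" for n
    using mangoldt_nonneg[of n] by (cases "n = 0") (auto simp: b_def)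
  have Re_term: "Re (of_real (mangoldt n / ln (real n)) * of_nat n powr (-Complex \<sigma> u)) = b n * cos (u * ln (real n))" for n u
  proof (cases "n = 0")
    case False
    hence "of_nat n powr (-Complex \<sigma> u) = exp (of_real (ln (real n)) * Complex (-\<sigma>) (-u))"
      by (simp add: powr_def Ln_of_nat Complex_eq algebra_simps)
    hence "Re (of_nat n powr (-Complex \<sigma> u)) = exp (-\<sigma> * ln (real n)) * cos (u * ln (real n))"
      by (simp add: Re_exp mult_ac)
    thus ?thesis using False by (simp add: b_def powr_def)
  qed (auto simp: b_def)
  have sums: "(\<lambda>n. b n * cos (u * ln (real n))) sums Re (log_zeta (Complex \<sigma> u))" for u
  proof -
    have "summable (\<lambda>n. of_real (mangoldt n / ln (real n)) * of_nat n powr (-Complex \<sigma> u))"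
      using assms by (intro summable_norm_cancel[OF summable_dirichlet] norm_mangoldt_div_ln_le) auto
    from sums_Re[OF summable_sums[OF this]] show ?thesis
      by (simp add: Re_term log_zeta_def del: times_complex.sel of_real_divide)
  qed
  have "(\<lambda>n. 3 * (b n * cos (0 * ln (real n))) + 4 * (b n * cos (t * ln (real n))) + b n * cos (2 * t * ln (real n)))
          sums (3 * Re (log_zeta (Complex \<sigma> 0)) + 4 * Re (log_zeta (Complex \<sigma> t)) + Re (log_zeta (Complex \<sigma> (2 * t))))"
    by (intro sums_add sums_mult sums)
  moreover have "3 * (b n * cos (0 * ln (real n))) + 4 * (b n * cos (t * ln (real n))) + b n * cos (2 * t * ln (real n)) =
                 2 * b n * (1 + cos (t * ln (real n))) ^ 2" for n
  proof -
    have "cos (2 * t * ln (real n)) = 2 * cos (t * ln (real n)) ^ 2 - 1"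
      using cos_double_cos[of "t * ln (real n)"] by (simp add: mult.assoc)
    thus ?thesis by (simp only:) (simp add: power2_eq_square algebra_simps)
  qed
  ultimately have "(\<lambda>n. 2 * b n * (1 + cos (t * ln (real n))) ^ 2)
          sums (3 * Re (log_zeta (Complex \<sigma> 0)) + 4 * Re (log_zeta (Complex \<sigma> t)) + Re (log_zeta (Complex \<sigma> (2 * t))))"
    by simp
  from sums_le[OF _ sums_zero this] show ?thesis
    using b by (simp add: complex_of_real_def)
qed

text \<open>Exponentiating the inequality for \<open>log_zeta\<close> leaves the factors s - 1:
  exactly \<sigma> - 1 at the real point, whence the third power, and at least |t| at the heights t
  (four times) and 2t (once), whence the fifth power. The constant is |c|^8 as 3 + 4 + 1 =
  8.\<close>

lemma zreg_341:
  "\<exists>K>0. \<forall>\<sigma> t. \<sigma> > 1 \<longrightarrow>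
     K * (\<sigma> - 1) ^ 3 * \<bar>t\<bar> ^ 5 \<le> 
     norm (zreg (of_real \<sigma>)) ^ 3 * norm (zreg (Complex \<sigma> t)) ^ 4 * norm (zreg (Complex \<sigma> (2 * t)))"
proof -
  obtain c where c: "c \<noteq> 0" "\<And>s. Re s > 1 \<Longrightarrow> zreg s = (s - 1) * c * exp (log_zeta s)"
    using zreg_eq_exp_log_zeta by blast
  show ?thesis
  proof (rule exI[of _ "norm c ^ 8"], safe)
    fix \<sigma> t :: real assume \<sigma>: "\<sigma> > 1"
    define e where "e = (\<lambda>u. exp (Re (log_zeta (Complex \<sigma> u))))"
    have Z: "norm (zreg (Complex \<sigma> u)) = norm (Complex \<sigma> u - 1) * (norm c * e u)" for u
      using \<sigma> by (simp add: c norm_mult e_def)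
    have Z0: "norm (zreg (of_real \<sigma>)) = (\<sigma> - 1) * (norm c * e 0)"
      using Z[of 0] \<sigma> norm_of_real[of "\<sigma> - 1", where ?'a = complex]
      by (simp add: complex_of_real_def [symmetric])
    have ge: "norm (Complex \<sigma> u - 1) \<ge> \<bar>u\<bar>" for u
      using abs_Im_le_cmod[of "Complex \<sigma> u - 1"] by simp
    have "e 0 ^ 3 * e t ^ 4 * e (2 * t) = exp (3 * Re (log_zeta (Complex \<sigma> 0)) + 4 * Re (log_zeta (Complex \<sigma> t)) +
            Re (log_zeta (Complex \<sigma> (2 * t))))"
      by (simp add: e_def exp_add flip: exp_of_nat_mult)
    also have "\<dots> \<ge> 1"
      using Re_log_zeta_341[OF \<sigma>, of t] by (simp add: complex_of_real_def)
    finally have e: "e 0 ^ 3 * e t ^ 4 * e (2 * t) \<ge> 1" .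
    have "norm c ^ 8 * (\<sigma> - 1) ^ 3 * \<bar>t\<bar> ^ 5 = (norm c ^ 8 * (\<sigma> - 1) ^ 3) * (\<bar>t\<bar> ^ 4 * \<bar>t\<bar>) * 1"
      by (simp add: eval_nat_numeral)
    also have "\<dots> \<le> (norm c ^ 8 * (\<sigma> - 1) ^ 3) * (norm (Complex \<sigma> t - 1) ^ 4 * norm (Complex \<sigma> (2*t) - 1)) *
                    (e 0 ^ 3 * e t ^ 4 * e (2 * t))"
      using ge[of t] ge[of "2 * t"] e \<sigma> by (intro mult_mono power_mono) auto
    also have "\<dots> = norm (zreg (of_real \<sigma>)) ^ 3 * norm (zreg (Complex \<sigma> t)) ^ 4 * norm (zreg (Complex \<sigma> (2 * t)))"
      unfolding Z Z0 by (simp add: power_mult_distrib eval_nat_numeral mult_ac)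
    finally show "norm c ^ 8 * (\<sigma> - 1) ^ 3 * \<bar>t\<bar> ^ 5 \<le> \<dots>" .
  qed (use c in auto)
qed

text \<open>Serves the bounded heights |Im s| \<le> 2, which \<open>zreg_lower_bound\<close> leaves
  out. At \<sigma> = 1 + h a zero would make the fourth power in \<open>zreg_341\<close> of order
  h^4, against a lower bound of order h^3; after division by h^3 a factor h remains and tends to
  0.\<close>

lemma zreg_nonzero_line: "zreg (Complex 1 t) \<noteq> 0"
proof
  assume zero: "zreg (Complex 1 t) = 0"
  have t: "t \<noteq> 0"
  proof
    assume "t = 0"
    hence "Complex 1 t = 1" by (simp add: complex_eq_iff)
    thus False using zero by simp
  qed
  obtain K where K: "K > 0" "\<And>\<sigma> t. \<sigma> > 1 \<Longrightarrow> K * (\<sigma> - 1) ^ 3 * \<bar>t\<bar> ^ 5 \<le> 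
     norm (zreg (of_real \<sigma>)) ^ 3 * norm (zreg (Complex \<sigma> t)) ^ 4 * norm (zreg (Complex \<sigma> (2 * t)))"
    using zreg_341 by blast
  have "(zreg has_field_derivative deriv zreg (Complex 1 t)) (at (Complex 1 t))"
    by (rule holomorphic_derivI[OF holomorphic_zreg_aux]) (auto simp: open_halfspace_Re_gt)
  hence "(\<lambda>h. (zreg (Complex 1 t + h) - zreg (Complex 1 t)) / h) \<midarrow>0\<rightarrow> deriv zreg (Complex 1 t)"
    by (simp add: DERIV_def)
  moreover have of_real_right: "filterlim (\<lambda>h. complex_of_real h) (at 0) (at_right 0)"
    unfolding filterlim_at by (auto intro!: tendsto_eq_intros simp: eventually_at_filter)
  ultimately have quot: "((\<lambda>h. (zreg (Complex 1 t + of_real h) - zreg (Complex 1 t)) / of_real h) \<longlongrightarrow>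
      deriv zreg (Complex 1 t)) (at_right 0)"
    by (rule filterlim_compose)
  have cont: "((\<lambda>h. zreg (s + of_real h)) \<longlongrightarrow> zreg s) (at_right 0)" if "Re s = 1" for s
    by (rule isCont_tendsto_compose[OF isCont_zreg])
       (use that in \<open>auto intro!: tendsto_eq_intros\<close>)
  have "((\<lambda>h. norm (zreg (1 + of_real h)) ^ 3 *
              norm ((zreg (Complex 1 t + of_real h) - zreg (Complex 1 t)) / of_real h) ^ 4 *
              h * norm (zreg (Complex 1 (2 * t) + of_real h))) \<longlongrightarrow>
         norm (zreg 1) ^ 3 * norm (deriv zreg (Complex 1 t)) ^ 4 * 0 * norm (zreg (Complex 1 (2 * t)))) (at_right 0)"
    by (intro tendsto_intros quot cont) auto
  moreover have "\<forall>\<^sub>F h in at_right 0. K * \<bar>t\<bar> ^ 5 \<le>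
              norm (zreg (1 + of_real h)) ^ 3 *
              norm ((zreg (Complex 1 t + of_real h) - zreg (Complex 1 t)) / of_real h) ^ 4 *
              h * norm (zreg (Complex 1 (2 * t) + of_real h))"
    using eventually_at_right_less[of 0]
  proof eventually_elim
    case (elim h)
    have shift: "Complex 1 u + of_real h = Complex (1 + h) u" for u by (simp add: complex_eq_iff)
    define A q B where "A = norm (zreg (of_real (1 + h)))" and "q = norm (zreg (Complex (1 + h) t))"
      and "B = norm (zreg (Complex (1 + h) (2 * t)))"
    have "h ^ 3 * (K * \<bar>t\<bar> ^ 5) \<le> A ^ 3 * q ^ 4 * B"
      using K(2)[of "1 + h" t] elim by (simp add: A_def q_def B_def mult_ac)
    also have "\<dots> = h ^ 3 * (A ^ 3 * (q / h) ^ 4 * h * B)"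
      using elim by (simp add: power_divide field_simps power3_eq_cube power4_eq_xxxx)
    finally have "K * \<bar>t\<bar> ^ 5 \<le> A ^ 3 * (q / h) ^ 4 * h * B"
      using elim by simp
    thus ?case
      using elim by (simp add: shift zero norm_divide A_def q_def B_def)
  qed
  ultimately have "K * \<bar>t\<bar> ^ 5 \<le> 0"
    by (intro tendsto_lowerbound) (auto simp: trivial_limit_at_right_real)
  moreover have "K * \<bar>t\<bar> ^ 5 > 0" using K t by simp
  ultimately show False by simp
qed

section \<open>A zero-free region\<close>

text \<open>From \<open>zreg_341\<close>, |Z(1 + \<eta> + it)| is at least a multiple of
  \<eta>^(3/4) times a power of t, and the bound for Z' moves this to every s within \<eta> of the
  line at a loss proportional to \<eta>. For \<eta> = \<kappa> |t|^(-1/4) both quantities carry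
  |t|^(4/5), since (5 - 3/4 - 21/20) / 4 = 21/20 - 1/4 = 4/5, so a small \<kappa> suffices.\<close>

lemma zreg_lower_bound:
  "\<exists>\<kappa>>0. \<exists>c>0. \<kappa> \<le> 1/40 \<and> (\<forall>s. \<bar>Im s\<bar> \<ge> 2 \<longrightarrow> \<bar>Re s - 1\<bar> \<le> \<kappa> * \<bar>Im s\<bar> powr (-1/4) \<longrightarrow>
      norm (zreg s) \<ge> c * \<bar>Im s\<bar> powr (4/5))"
proof -
  obtain K where K: "K > 0" "\<And>\<sigma> t. \<sigma> > 1 \<Longrightarrow> K * (\<sigma> - 1) ^ 3 * \<bar>t\<bar> ^ 5 \<le> 
     norm (zreg (of_real \<sigma>)) ^ 3 * norm (zreg (Complex \<sigma> t)) ^ 4 * norm (zreg (Complex \<sigma> (2 * t)))"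
    using zreg_341 by blast
  obtain C1 where C1: "C1 > 0" "\<And>s. 39/40 \<le> Re s \<Longrightarrow> Re s \<le> 2 \<Longrightarrow> \<bar>Im s\<bar> \<ge> 2 \<Longrightarrow> 
         norm (deriv zreg s) \<le> C1 * \<bar>Im s\<bar> powr (21/20)"
    using norm_deriv_zreg_le by blast
  have "compact (zreg ` of_real ` {1..2})"
    by (intro compact_continuous_image holomorphic_on_imp_continuous_on holomorphic_zreg continuous_intros) auto
  hence "bounded (zreg ` of_real ` {1..2})" by (rule compact_imp_bounded)
  then obtain C0 where C0: "C0 > 0" "\<And>\<sigma>. 1 \<le> \<sigma> \<Longrightarrow> \<sigma> \<le> 2 \<Longrightarrow> norm (zreg (of_real \<sigma>)) \<le> C0"
    unfolding bounded_pos by auto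
  define P where "P = C0 ^ 3 * (158 * 2 powr (21/20))"
  have P: "P > 0" using C0 by (simp add: P_def)
  \<comment> \<open>\<open>P\<close> collects the upper bounds for the factors at the heights 0 and
    2t; the root isolates the factor at height t, which occurs to the fourth power.\<close>
  define K3 where "K3 = root 4 (K / P)"
  have K3: "K3 > 0" "K3 ^ 4 = K / P" using K P by (simp_all add: K3_def)
  \<comment> \<open>With \<kappa> = l^4 the lower bound has the coefficient K3 l^3 (the fourth root
    of l^12 enters) and the loss 2 C1 l^4; 4 C1 l \<le> K3 keeps the loss below half of the lower
    bound.\<close>
  define l where "l = min (1/4) (K3 / (4 * C1))"
  have l: "l > 0" "l \<le> 1/4" "4 * C1 * l \<le> K3" using K3 C1 by (auto simp: l_def min_def field_simps)
  have l4: "l ^ 4 \<le> 1/40" using power_mono[of l "1/4" 4] l by (simp add: eval_nat_numeral)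
  show ?thesis
  proof (rule exI[of _ "l ^ 4"], intro conjI exI[of _ "K3 * l ^ 3 / 2"] allI impI)
    fix s assume s: "\<bar>Im s\<bar> \<ge> 2" "\<bar>Re s - 1\<bar> \<le> l ^ 4 * \<bar>Im s\<bar> powr (-1/4)"
    define t where "t = Im s"
    define \<tau> where "\<tau> = \<bar>t\<bar>"
    define \<eta> where "\<eta> = l ^ 4 * \<tau> powr (-1/4)"
    have \<tau>: "\<tau> \<ge> 2" using s by (simp add: \<tau>_def t_def)
    have "\<tau> powr (-1/4) \<le> 2 powr (-1/4)" using \<tau> by (intro powr_mono2') auto
    also have "\<dots> \<le> 2 powr 0" by (intro powr_mono) auto
    finally have \<eta>: "\<eta> > 0" "\<eta> \<le> 1/40"
      using l4 l \<tau> mult_mono[OF l4, of "\<tau> powr (-1/4)" 1] by (auto simp: \<eta>_def)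
    have pw: "(\<tau> powr (-1/4)) ^ 3 * \<tau> ^ 5 = \<tau> powr (17/4)" 
    proof -
      have "(\<tau> powr (-1/4)) ^ 3 = \<tau> powr (-3/4)" using \<tau> by (simp add: powr_power)
      moreover have "\<tau> ^ 5 = \<tau> powr 5" using \<tau> by simp
      ultimately show ?thesis by (simp only: powr_add [symmetric]) simp
    qed
    have pw2: "\<tau> powr (17/4) = (\<tau> powr (4/5)) ^ 4 * \<tau> powr (21/20)"
    proof -
      have "(\<tau> powr (4/5)) ^ 4 = \<tau> powr (16/5)" using \<tau> by (simp add: powr_power)
      thus ?thesis by (simp only: powr_add [symmetric]) simp
    qed
    have "K * \<eta> ^ 3 * \<tau> ^ 5 \<le> norm (zreg (of_real (1 + \<eta>))) ^ 3 * 
             norm (zreg (Complex (1 + \<eta>) t)) ^ 4 * norm (zreg (Complex (1 + \<eta>) (2 * t)))"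
      using K(2)[of "1 + \<eta>" t] \<eta> by (simp add: \<tau>_def)
    also have "\<dots> \<le> C0 ^ 3 * norm (zreg (Complex (1 + \<eta>) t)) ^ 4 * (158 * (2 powr (21/20) * \<tau> powr (21/20)))"
    proof (intro mult_mono power_mono)
      show "norm (zreg (of_real (1 + \<eta>))) \<le> C0" using \<eta> by (intro C0) auto
      have "norm (zreg (Complex (1 + \<eta>) (2 * t))) \<le> 158 * \<bar>2 * t\<bar> powr (21/20)"
        using norm_zreg_le[of "Complex (1 + \<eta>) (2 * t)"] \<eta> \<tau> by (simp add: \<tau>_def)
      thus "norm (zreg (Complex (1 + \<eta>) (2 * t))) \<le> 158 * (2 powr (21/20) * \<tau> powr (21/20))"
        by (simp add: abs_mult powr_mult \<tau>_def)
    qed (use C0 in auto)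
    also have "\<dots> = P * norm (zreg (Complex (1 + \<eta>) t)) ^ 4 * \<tau> powr (21/20)" by (simp add: P_def)
    also have "K * \<eta> ^ 3 * \<tau> ^ 5 = K * l ^ 12 * ((\<tau> powr (-1/4)) ^ 3 * \<tau> ^ 5)"
      by (simp add: \<eta>_def power_mult_distrib flip: power_mult)
    also have "\<dots> = K * l ^ 12 * (\<tau> powr (4/5)) ^ 4 * \<tau> powr (21/20)" by (simp only: pw pw2 mult.assoc)
    finally have "K * l ^ 12 * (\<tau> powr (4/5)) ^ 4 \<le> P * norm (zreg (Complex (1 + \<eta>) t)) ^ 4"
      using \<tau> by simp
    hence "(K / P) * l ^ 12 * (\<tau> powr (4/5)) ^ 4 \<le> norm (zreg (Complex (1 + \<eta>) t)) ^ 4"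
      using P by (simp add: field_simps)
    also have "(K / P) * l ^ 12 * (\<tau> powr (4/5)) ^ 4 = (K3 * l ^ 3 * \<tau> powr (4/5)) ^ 4"
      by (simp add: power_mult_distrib K3 flip: power_mult)
    \<comment> \<open>\<open>power_le_imp_le_base\<close> speaks of the exponent
      \<open>Suc n\<close>; hence 3 for fourth powers.\<close>
    finally have 1: "K3 * l ^ 3 * \<tau> powr (4/5) \<le> norm (zreg (Complex (1 + \<eta>) t))"
      by (rule power_le_imp_le_base[of _ 3, simplified]) auto
    have s_eq: "s = Complex (Re s) t" by (simp add: t_def)
    have sr: "\<bar>Re s - 1\<bar> \<le> \<eta>" using s by (simp add: \<eta>_def \<tau>_def t_def)
    have "norm (zreg (Complex (1 + \<eta>) t) - zreg s) \<le> (C1 * \<tau> powr (21/20)) * norm (Complex (1 + \<eta>) t - s)"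
    proof (rule field_differentiable_bound[of "closed_segment s (Complex (1 + \<eta>) t)"])
      fix z assume "z \<in> closed_segment s (Complex (1 + \<eta>) t)"
      hence "Im z = t \<and> \<bar>Re z - 1\<bar> \<le> \<eta>"
        using \<eta> sr by (subst (asm) s_eq) 
          (auto simp: closed_segment_same_Im closed_segment_eq_real_ivl split: if_splits)
      hence z: "Im z = t" "\<bar>Re z - 1\<bar> \<le> 1/40" using \<eta> by auto
      show "(zreg has_field_derivative deriv zreg z) (at z within closed_segment s (Complex (1 + \<eta>) t))"
        by (rule has_field_derivative_at_within, rule holomorphic_derivI[OF holomorphic_zreg_aux])
           (use z open_halfspace_Re_gt[of 0] in \<open>auto simp: abs_if split: if_splits\<close>)
      show "norm (deriv zreg z) \<le> C1 * \<tau> powr (21/20)"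
        using C1(2)[of z] z \<tau> by (auto simp: \<tau>_def abs_if split: if_splits)
    qed auto
    also have "Complex (1 + \<eta>) t - s = of_real (1 + \<eta> - Re s)"
      by (simp add: complex_eq_iff t_def)
    also have "norm \<dots> \<le> 2 * \<eta>" unfolding norm_of_real using sr by linarith
    also have "C1 * \<tau> powr (21/20) * (2 * \<eta>) = 2 * C1 * l ^ 4 * (\<tau> powr (21/20) * \<tau> powr (-1/4))"
      by (simp add: \<eta>_def)
    also have "\<tau> powr (21/20) * \<tau> powr (-1/4) = \<tau> powr (4/5)" by (simp flip: powr_add)
    also have "2 * C1 * l ^ 4 * \<tau> powr (4/5) = (4 * C1 * l) * (l ^ 3 * \<tau> powr (4/5) / 2)"
      by (simp add: eval_nat_numeral)
    also have "\<dots> \<le> K3 * (l ^ 3 * \<tau> powr (4/5) / 2)" using l by (intro mult_right_mono) auto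
    finally have 2: "norm (zreg (Complex (1 + \<eta>) t) - zreg s) \<le> K3 * l ^ 3 / 2 * \<tau> powr (4/5)"
      using C1 \<tau> by (simp add: mult_left_mono)
    have "norm (zreg (Complex (1 + \<eta>) t)) \<le> norm (zreg s) + norm (zreg (Complex (1 + \<eta>) t) - zreg s)"
      by norm
    with 1 2 show "K3 * l ^ 3 / 2 * \<bar>Im s\<bar> powr (4/5) \<le> norm (zreg s)"
      by (simp add: \<tau>_def t_def)
  qed (use l K3 l4 in auto)
qed

text \<open>Compactness: the open set where Z is nonzero contains the segment from 1 - 2i to 1 + 2i,
  hence a uniform neighbourhood of it.\<close>

lemma zreg_nonzero_near_line:
  "\<exists>\<delta>>0. \<forall>s. \<bar>Im s\<bar> \<le> 2 \<longrightarrow> \<bar>Re s - 1\<bar> \<le> \<delta> \<longrightarrow> Re s > 0 \<and> zreg s \<noteq> 0"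
proof -
  define U where "U = {s. Re s > 0} \<inter> zreg -` (-{0})"
  define S where "S = closed_segment (Complex 1 (-2)) (Complex 1 2)"
  have S: "z \<in> S \<longleftrightarrow> Re z = 1 \<and> \<bar>Im z\<bar> \<le> 2" for z
    by (auto simp: S_def closed_segment_same_Re closed_segment_eq_real_ivl)
  have "open U" unfolding U_def
    by (rule continuous_open_preimage[OF holomorphic_on_imp_continuous_on[OF holomorphic_zreg_aux] open_halfspace_Re_gt]) auto
  moreover have "S \<subseteq> U"
  proof
    fix z assume "z \<in> S"
    hence "z = Complex 1 (Im z)" by (simp add: S complex_eq_iff)
    thus "z \<in> U" using zreg_nonzero_line[of "Im z"] \<open>z \<in> S\<close> by (simp add: U_def S)
  qed
  moreover have "compact S" by (simp add: S_def)
  ultimately obtain e where e: "e > 0" "(\<Union>x\<in>S. ball x e) \<subseteq> U"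
    by (metis compact_subset_open_imp_ball_epsilon_subset)
  show ?thesis
  proof (rule exI[of _ "e / 2"], intro conjI allI impI)
    fix s assume s: "\<bar>Im s\<bar> \<le> 2" "\<bar>Re s - 1\<bar> \<le> e / 2"
    have "Complex 1 (Im s) - s = of_real (1 - Re s)" by (simp add: complex_eq_iff)
    hence "dist (Complex 1 (Im s)) s = \<bar>1 - Re s\<bar>" by (simp only: dist_norm norm_of_real)
    moreover have "\<bar>1 - Re s\<bar> < e" using s(2) e(1) by (simp add: abs_minus_commute)
    ultimately have "s \<in> ball (Complex 1 (Im s)) e" by simp
    moreover have "Complex 1 (Im s) \<in> S" using s by (simp add: S)
    ultimately have "s \<in> U" using e by blast
    thus "Re s > 0" "zreg s \<noteq> 0" by (auto simp: U_def)
  qed (use e in auto)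
qed

text \<open>The analytic continuation of \<open>- \<zeta>'(s) / \<zeta>(s) - \<zeta>(s)\<close>, in which the two poles at \<open>s = 1\<close> cancel.\<close>
definition mangoldt_diff :: "complex \<Rightarrow> complex" where
  "mangoldt_diff s = - (deriv zreg s / zreg s) - (if s = 1 then deriv zreg 1 else (zreg s - zreg 1) / (s - 1))"

text \<open>The case distinction in \<open>mangoldt_diff\<close> is the difference quotient of Z at
  1, in the form in which \<open>pole_lemma_open\<close> removes the singularity.\<close>

lemma holomorphic_mangoldt_diff:
  assumes "open A" "\<And>s. s \<in> A \<Longrightarrow> Re s > 0 \<and> zreg s \<noteq> 0"
  shows   "mangoldt_diff holomorphic_on A"
proof -
  have hol: "zreg holomorphic_on A" using assms by (intro holomorphic_zreg) auto
  show ?thesis unfolding mangoldt_diff_def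
    by (intro holomorphic_intros pole_lemma_open hol assms(1) holomorphic_deriv) (use assms in auto)
qed

text \<open>With D the series of \<Lambda>, Z = (s - 1) \<zeta> and \<zeta>' = -D \<zeta> give -Z'/Z
  = D - 1/(s - 1) and (Z - 1)/(s - 1) = \<zeta> - 1/(s - 1), so the polar parts cancel.\<close>

lemma sums_mangoldt_diff:
  assumes s: "Re s > 1"
  shows   "(\<lambda>n. (mangoldt n - 1) * of_nat n powr (-s)) sums mangoldt_diff s"
proof -
  define \<zeta> where "\<zeta> = (\<lambda>s. \<Sum>n. 1 * of_nat n powr (-s) :: complex)"
  define D where "D = (\<Sum>n. mangoldt n * of_nat n powr (-s) :: complex)"
  have D: "(\<lambda>n. mangoldt n * of_nat n powr (-s)) sums D"
    unfolding D_def by (intro summable_sums summable_norm_cancel[OF summable_mangoldt[OF s]])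
  have \<zeta>: "(\<lambda>n. 1 * of_nat n powr (-s)) sums \<zeta> s"
    unfolding \<zeta>_def using s by (intro summable_sums summable_norm_cancel[OF summable_dirichlet]) auto
  have "(\<Sum>n. 1 * (- of_real (ln (real n)) * of_nat n powr (-s)) :: complex) = - (\<Sum>n. of_real (ln (real n)) * of_nat n powr (-s))"
    using summable_dirichlet_deriv[of "\<lambda>_. 1" s] s
    by (subst suminf_minus [symmetric]) (auto simp: summable_minus_iff)
  also have "\<dots> = - (D * \<zeta> s)"
    using mangoldt_times_zeta[OF s] by (simp add: D_def \<zeta>_def)
  finally have "(\<zeta> has_field_derivative - (D * \<zeta> s)) (at s)"
    unfolding \<zeta>_def using has_field_derivative_dirichlet[of "\<lambda>_. 1" s] s by simp
  hence "((\<lambda>s. (s - 1) * \<zeta> s) has_field_derivative (\<zeta> s - (s - 1) * (D * \<zeta> s))) (at s)"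
    by (auto intro!: derivative_eq_intros)
  hence "(zreg has_field_derivative (\<zeta> s - (s - 1) * (D * \<zeta> s))) (at s)"
    by (rule has_field_derivative_transform_within_open[of _ _ _ "{s. Re s > 1}"])
       (use s open_halfspace_Re_gt in \<open>auto simp: zreg_eq_zeta \<zeta>_def\<close>)
  hence deriv: "deriv zreg s = \<zeta> s - (s - 1) * (D * \<zeta> s)" by (rule DERIV_imp_deriv)
  have zreg: "zreg s = (s - 1) * \<zeta> s" using zreg_eq_zeta[OF s] by (simp add: \<zeta>_def)
  have [simp]: "s \<noteq> 1" using s by auto
  have [simp]: "\<zeta> s \<noteq> 0" using zreg zreg_nonzero_Re_gt_1[OF s] by auto
  have "mangoldt_diff s = D - \<zeta> s"
    by (simp add: mangoldt_diff_def deriv zreg divide_simps) (simp add: algebra_simps)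
  thus ?thesis using sums_diff[OF D \<zeta>] by (simp add: left_diff_distrib)
qed

text \<open>The contour needs one width for all heights up to R. The admissible width shrinks with
  the height, so the one at R serves everywhere; heights up to 2 are settled by compactness.\<close>

lemma zero_free_region:
  "\<exists>\<kappa>>0. \<exists>M>0. \<kappa> \<le> 1/40 \<and> (\<forall>R\<ge>2. \<forall>s. \<bar>Im s\<bar> \<le> R \<longrightarrow> Re s \<ge> 1 - \<kappa> * R powr (-1/4) \<longrightarrow>
      zreg s \<noteq> 0 \<and> (Re s \<le> 1 \<longrightarrow> norm (mangoldt_diff s) \<le> M * R powr (1/4)))"
proof -
  obtain \<kappa>0 c where c: "\<kappa>0 > 0" "c > 0" "\<kappa>0 \<le> 1/40" 
    "\<And>s. \<bar>Im s\<bar> \<ge> 2 \<Longrightarrow> \<bar>Re s - 1\<bar> \<le> \<kappa>0 * \<bar>Im s\<bar> powr (-1/4) \<Longrightarrow>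
      norm (zreg s) \<ge> c * \<bar>Im s\<bar> powr (4/5)" using zreg_lower_bound by blast
  obtain \<delta> where \<delta>: "\<delta> > 0" "\<And>s. \<bar>Im s\<bar> \<le> 2 \<Longrightarrow> \<bar>Re s - 1\<bar> \<le> \<delta> \<Longrightarrow> Re s > 0 \<and> zreg s \<noteq> 0"
    using zreg_nonzero_near_line by blast
  obtain C1 where C1: "C1 > 0" "\<And>s. 39/40 \<le> Re s \<Longrightarrow> Re s \<le> 2 \<Longrightarrow> \<bar>Im s\<bar> \<ge> 2 \<Longrightarrow> 
         norm (deriv zreg s) \<le> C1 * \<bar>Im s\<bar> powr (21/20)"
    using norm_deriv_zreg_le by blast
  define \<kappa> where "\<kappa> = min \<kappa>0 \<delta>"
  have \<kappa>: "\<kappa> > 0" "\<kappa> \<le> \<kappa>0" "\<kappa> \<le> \<delta>" "\<kappa> \<le> 1/40" using c \<delta> by (auto simp: \<kappa>_def)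
  define S where "S = cbox (Complex (1 - \<kappa>) (-2)) (Complex 1 2)"
  define U where "U = {s. Re s > 0} \<inter> zreg -` (-{0})"
  have "open U" unfolding U_def
    by (rule continuous_open_preimage[OF holomorphic_on_imp_continuous_on[OF holomorphic_zreg_aux] open_halfspace_Re_gt]) auto
  hence "mangoldt_diff holomorphic_on U"
    by (rule holomorphic_mangoldt_diff) (auto simp: U_def)
  moreover have "S \<subseteq> U"
    using \<kappa> \<delta> by (auto simp: S_def U_def in_cbox_complex_iff)
  ultimately have "continuous_on S mangoldt_diff"
    using holomorphic_on_subset holomorphic_on_imp_continuous_on by blast
  hence "compact (mangoldt_diff ` S)" by (intro compact_continuous_image) (auto simp: S_def)
  hence "bounded (mangoldt_diff ` S)" by (rule compact_imp_bounded)
  then obtain M0 where M0: "M0 > 0" "\<And>s. s \<in> S \<Longrightarrow> norm (mangoldt_diff s) \<le> M0"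
    unfolding bounded_pos by auto
  \<comment> \<open>\<open>M0\<close> bounds \<open>mangoldt_diff\<close> at heights up to 2. Above,
    \<open>C1 / c\<close> comes from Z'/Z, with exponent 21/20 - 4/5 = 1/4, and 159 = 158 + 1 from
    |Z - 1|.\<close>
  define M where "M = M0 + C1 / c + 159"
  show ?thesis
  proof (rule exI[of _ \<kappa>], intro conjI exI[of _ M] allI impI)
    fix R :: real and s :: complex
    assume R: "R \<ge> 2" and s: "\<bar>Im s\<bar> \<le> R" "Re s \<ge> 1 - \<kappa> * R powr (-1/4)"
    have "R powr (-1/4) \<le> R powr 0" using R by (intro powr_mono) auto
    hence "\<kappa> * R powr (-1/4) \<le> \<kappa> * 1" using \<kappa> R by (intro mult_left_mono) auto
    hence s1: "Re s \<ge> 1 - \<kappa>" using s by simp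
    have large: "\<bar>Re s - 1\<bar> \<le> \<kappa>0 * \<bar>Im s\<bar> powr (-1/4)" if "\<bar>Im s\<bar> \<ge> 2" "Re s \<le> 1"
    proof -
      have "\<bar>Re s - 1\<bar> \<le> \<kappa> * R powr (-1/4)" using s that by linarith
      also have "\<dots> \<le> \<kappa>0 * \<bar>Im s\<bar> powr (-1/4)"
        using \<kappa> c that s by (intro mult_mono powr_mono2') auto
      finally show ?thesis .
    qed
    show "zreg s \<noteq> 0"
    proof (cases "Re s > 1")
      case False
      show ?thesis
      proof (cases "\<bar>Im s\<bar> \<le> 2")
        case True
        thus ?thesis using False s1 \<kappa> \<delta>(2)[of s] by auto
      next
        case im: False
        have "0 < c * \<bar>Im s\<bar> powr (4/5)" using c im by simp
        also have "\<dots> \<le> norm (zreg s)" using im False by (intro c large) auto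
        finally show ?thesis by auto
      qed
    qed (use zreg_nonzero_Re_gt_1 in auto)
    assume s2: "Re s \<le> 1"
    have R14: "R powr (1/4) \<ge> 1" using R by (intro ge_one_powr_ge_zero) auto
    show "norm (mangoldt_diff s) \<le> M * R powr (1/4)"
    proof (cases "\<bar>Im s\<bar> \<le> 2")
      case True
      hence "norm (mangoldt_diff s) \<le> M0 * 1"
        using s1 s2 by (auto intro!: M0 simp: S_def in_cbox_complex_iff)
      also have "\<dots> \<le> M * R powr (1/4)"
        using M0 C1 c R14 by (intro mult_mono) (auto simp: M_def)
      finally show ?thesis .
    next
      case False
      define t where "t = \<bar>Im s\<bar>"
      have t: "t \<ge> 2" "t \<le> R" using False s by (auto simp: t_def)
      have lower: "norm (zreg s) \<ge> c * t powr (4/5)"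
        unfolding t_def using False s2 by (intro c large) auto
      have upper: "norm (deriv zreg s) \<le> C1 * t powr (21/20)"
        unfolding t_def using False s1 s2 \<kappa> by (intro C1) auto
      have "norm (deriv zreg s / zreg s) \<le> (C1 * t powr (21/20)) / (c * t powr (4/5))"
        unfolding norm_divide using lower upper c t C1 by (intro frac_le) auto
      also have "\<dots> = C1 / c * (t powr (21/20) / t powr (4/5))" by simp
      also have "t powr (21/20) / t powr (4/5) = t powr (1/4)" by (simp flip: powr_diff)
      also have "t powr (1/4) \<le> R powr (1/4)" using t by (intro powr_mono2) auto
      finally have 1: "norm (deriv zreg s / zreg s) \<le> C1 / c * R powr (1/4)"
        using c C1 by (simp add: mult_left_mono divide_right_mono)
      have ne: "s \<noteq> 1" using False by auto
      have "norm (zreg s - 1) \<le> norm (zreg s) + 1" using norm_triangle_ineq4[of "zreg s" 1] by simp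
      also have "norm (zreg s) \<le> 158 * t powr (21/20)"
        unfolding t_def using s1 s2 \<kappa> False by (intro norm_zreg_le) auto
      also have "158 * t powr (21/20) + 1 \<le> 159 * t powr (21/20)"
        using ge_one_powr_ge_zero[of t "21/20"] t by simp
      finally have "norm ((zreg s - 1) / (s - 1)) \<le> 159 * t powr (21/20) / t"
        unfolding norm_divide using t abs_Im_le_cmod[of "s - 1"]
        by (intro frac_le) (auto simp: t_def)
      also have "\<dots> = 159 * (t powr (21/20) / t powr 1)" using t by simp
      also have "t powr (21/20) / t powr 1 = t powr (1/20)" by (subst powr_diff [symmetric]) simp
      also have "t powr (1/20) \<le> t powr (1/4)" using t by (intro powr_mono) auto
      also have "t powr (1/4) \<le> R powr (1/4)" using t by (intro powr_mono2) auto
      finally have 2: "norm ((zreg s - 1) / (s - 1)) \<le> 159 * R powr (1/4)" by simp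
      have "norm (mangoldt_diff s) \<le> norm (deriv zreg s / zreg s) + norm ((zreg s - 1) / (s - 1))"
        using norm_triangle_ineq4[of "- (deriv zreg s / zreg s)" "(zreg s - 1) / (s - 1)"] ne
        by (simp add: mangoldt_diff_def)
      also have "\<dots> \<le> C1 / c * R powr (1/4) + 159 * R powr (1/4)" using 1 2 by linarith
      also have "\<dots> = (C1 / c + 159) * R powr (1/4)" by (simp add: algebra_simps)
      also have "\<dots> \<le> M * R powr (1/4)" using M0 by (intro mult_right_mono) (auto simp: M_def)
      finally show ?thesis .
    qed
  qed (use \<kappa> M0 C1 c in \<open>auto simp: M_def intro!: add_pos_pos\<close>)
qed

section \<open>The contour argument\<close>

text \<open>f(z) / z splits into the removable part (f(z) - f(0)) / z and f(0) / z. As P is fixed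
  before the path, its increments telescope along consecutive paths, and Cauchy's integral formula
  reduces to adding up the integrals of 1 / z.\<close>

lemma contour_integral_simple_pole:
  assumes "open V" "convex V" "f holomorphic_on V"
  shows   "\<exists>P. \<forall>g j. valid_path g \<longrightarrow> path_image g \<subseteq> V - {0} \<longrightarrow> ((\<lambda>z. 1 / z) has_contour_integral j) g \<longrightarrow>
             ((\<lambda>z. f z / z) has_contour_integral (P (pathfinish g) - P (pathstart g) + f 0 * j)) g"
proof -
  define h where "h = (\<lambda>z. if z = 0 then deriv f 0 else (f z - f 0) / (z - 0))"
  have "h holomorphic_on V" unfolding h_def by (rule pole_lemma_open) fact+
  then obtain P where P: "\<And>z. z \<in> V \<Longrightarrow> (P has_field_derivative h z) (at z within V)"
    using holomorphic_convex_primitive'[OF assms(2,1)] by metis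
  show ?thesis
  proof (intro exI[of _ P] allI impI)
    fix g j assume g: "valid_path g" "path_image g \<subseteq> V - {0}" "((\<lambda>z. 1 / z) has_contour_integral j) g"
    have "(h has_contour_integral (P (pathfinish g) - P (pathstart g))) g"
      by (rule contour_integral_primitive[of V, OF P]) (use g in auto)
    hence "((\<lambda>z. h z + f 0 * (1 / z)) has_contour_integral (P (pathfinish g) - P (pathstart g) + f 0 * j)) g"
      by (intro has_contour_integral_add has_contour_integral_lmul g)
    thus "((\<lambda>z. f z / z) has_contour_integral (P (pathfinish g) - P (pathstart g) + f 0 * j)) g"
      by (rule has_contour_integral_eq) (use g in \<open>auto simp: h_def diff_divide_distrib\<close>)
  qed
qed

text \<open>On the circle R^2 = z \<open>cnj z\<close>, so R^2 + z^2 = z (\<open>cnj z\<close> + z)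
  = 2 z Re z.\<close>

lemma norm_one_plus_square_circle:
  assumes "norm z = R" "R > 0"
  shows   "norm (1 + z ^ 2 / of_real R ^ 2) = 2 * \<bar>Re z\<bar> / R"
proof -
  have "of_real (R ^ 2) = z * cnj z" using assms by (simp add: complex_norm_square [symmetric])
  hence "of_real (R ^ 2) + z ^ 2 = z * of_real (2 * Re z)"
    by (simp only: complex_add_cnj [symmetric] power2_eq_square distrib_left add.commute)
  moreover have "1 + z ^ 2 / of_real R ^ 2 = (of_real (R ^ 2) + z ^ 2) / of_real (R ^ 2)"
    using assms by (simp add: field_simps)
  ultimately have "norm (1 + z ^ 2 / of_real R ^ 2) = norm (z * of_real (2 * Re z) / of_real (R ^ 2))"
    by simp
  also have "\<dots> = 2 * \<bar>Re z\<bar> / R"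
    using assms by (simp add: norm_mult norm_divide norm_power power2_eq_square abs_mult)
  finally show ?thesis .
qed

lemma half_circle_path_images:
  assumes "R > 0"
  shows "z \<in> path_image (part_circlepath 0 R (-pi/2) (pi/2)) \<Longrightarrow> norm z = R \<and> Re z \<ge> 0"
    and "z \<in> path_image (part_circlepath 0 R (pi/2) (3*pi/2)) \<Longrightarrow> norm z = R \<and> Re z \<le> 0"
proof -
  show "norm z = R \<and> Re z \<ge> 0" if "z \<in> path_image (part_circlepath 0 R (-pi/2) (pi/2))"
  proof -
    from that obtain x where x: "z = of_real R * exp (\<i> * of_real x)" "-pi/2 \<le> x" "x \<le> pi/2"
      by (auto simp: path_image_part_circlepath)
    moreover have "cos x \<ge> 0" using x by (intro cos_ge_zero) auto
    ultimately show ?thesis using assms by (simp add: norm_mult Re_exp)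
  qed
  show "norm z = R \<and> Re z \<le> 0" if "z \<in> path_image (part_circlepath 0 R (pi/2) (3*pi/2))"
  proof -
    from that obtain x where x: "z = of_real R * exp (\<i> * of_real x)" "pi/2 \<le> x" "x \<le> 3*pi/2"
      by (auto simp: path_image_part_circlepath)
    have "cos (x - pi) \<ge> 0" using x by (intro cos_ge_zero) auto
    hence "cos x \<le> 0" by simp
    with x show ?thesis using assms by (simp add: norm_mult Re_exp mult_nonneg_nonpos)
  qed
qed

text \<open>
  Newman's kernel with a squared factor \<open>(1 + z\<^sup>2 / R\<^sup>2)\<^sup>2\<close>, whose double zeros at \<open>z = \<plusminus>\<i>R\<close> compensate a bound
  of order \<open>1 / (Re z)\<^sup>2\<close> on \<open>F - S\<close>; such a bound needs no Chebyshev estimate for the coefficients.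
  Left of the imaginary axis, \<open>F\<close> is integrated along three sides of a rectangle of width \<open>d\<close> and the
  entire function \<open>S\<close> along a half circle.
\<close>
lemma newman_contour_bound:
  fixes F S :: "complex \<Rightarrow> complex" and R d T A1 A2 M :: real
  assumes R: "R > 0" and d: "0 < d" "d \<le> R" "d < d'" "R < R'" and T: "T \<ge> 0"
  assumes F: "F holomorphic_on {z. Re z > -d' \<and> \<bar>Im z\<bar> < R'}" and S: "S holomorphic_on UNIV"
  assumes right: "\<And>z. norm z = R \<Longrightarrow> Re z > 0 \<Longrightarrow> norm (F z - S z) * exp (T * Re z) * (Re z)\<^sup>2 \<le> A1"
  assumes left: "\<And>z. norm z = R \<Longrightarrow> Re z < 0 \<Longrightarrow> norm (S z) * exp (T * Re z) * (Re z)\<^sup>2 \<le> A2"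
  assumes M: "\<And>z. -d \<le> Re z \<Longrightarrow> Re z \<le> 0 \<Longrightarrow> \<bar>Im z\<bar> \<le> R \<Longrightarrow> norm (F z) \<le> M"
  shows "2 * pi * norm (F 0 - S 0) \<le>
           4 * pi * (A1 + A2) / R ^ 2 + 18 * M * d / R + 18 * M * R * exp (-d * T) / d"
proof -
  define V where "V = {z. Re z > -d' \<and> \<bar>Im z\<bar> < R'}"
  define K where "K = (\<lambda>z::complex. exp (z * of_real T) * (1 + z ^ 2 / of_real R ^ 2) ^ 2)"
  define q where "q = (\<lambda>z. (F z - S z) * K z)"
  have V_eq: "V = {z. Re z > -d'} \<inter> {z. Im z > -R'} \<inter> {z. Im z < R'}" by (auto simp: V_def)
  have V: "open V" "convex V"
    unfolding V_eq by (auto intro!: open_Int convex_Int open_halfspace_Re_gt open_halfspace_Im_gt open_halfspace_Im_lt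
       convex_halfspace_Re_gt convex_halfspace_Im_gt convex_halfspace_Im_lt)
  have K_hol: "K holomorphic_on A" for A unfolding K_def using R by (intro holomorphic_intros) auto
  have q_hol: "q holomorphic_on V" unfolding q_def
    using F S K_hol by (auto simp: V_def intro!: holomorphic_intros intro: holomorphic_on_subset)
  have SK_hol: "(\<lambda>z. S z * K z) holomorphic_on UNIV" using S K_hol by (intro holomorphic_intros)
  have [simp]: "K 0 = 1" by (simp add: K_def)
  have K_circle: "norm (K z) = exp (T * Re z) * (2 * \<bar>Re z\<bar> / R) ^ 2" if "norm z = R" for z
    unfolding K_def norm_mult norm_power norm_one_plus_square_circle[OF that R] by (simp add: mult.commute)
  have K_left: "norm (K z) \<le> 9 * exp (T * Re z)" if "-d \<le> Re z" "Re z \<le> 0" "\<bar>Im z\<bar> \<le> R" for z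
  proof -
    have "norm z ^ 2 = (Re z)\<^sup>2 + (Im z)\<^sup>2" by (simp add: cmod_power2)
    also have "\<dots> \<le> R ^ 2 + R ^ 2"
      using that d by (intro add_mono; subst abs_le_square_iff [symmetric]) auto
    finally have "norm (z ^ 2 / of_real R ^ 2) \<le> 2"
      using R by (simp add: norm_divide norm_power divide_simps)
    hence "norm (1 + z ^ 2 / of_real R ^ 2) \<le> 3"
      using norm_triangle_ineq[of 1 "z ^ 2 / of_real R ^ 2"] by simp
    hence "norm (1 + z ^ 2 / of_real R ^ 2) ^ 2 \<le> 3 ^ 2" by (rule power_mono) auto
    thus ?thesis unfolding K_def norm_mult norm_power by (simp add: mult.commute)
  qed
  \<comment> \<open>Two primitives for two domains: q is holomorphic only on V, whereas the integral
    of S K also runs over the left half circle, which need not lie in V.\<close>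
  obtain P where P: "\<And>g j. valid_path g \<Longrightarrow> path_image g \<subseteq> V - {0} \<Longrightarrow> ((\<lambda>z. 1 / z) has_contour_integral j) g \<Longrightarrow>
             ((\<lambda>z. q z / z) has_contour_integral (P (pathfinish g) - P (pathstart g) + q 0 * j)) g"
    using contour_integral_simple_pole[OF V q_hol] by blast
  obtain Q where Q: "\<And>g j. valid_path g \<Longrightarrow> path_image g \<subseteq> UNIV - {0} \<Longrightarrow> ((\<lambda>z. 1 / z) has_contour_integral j) g \<Longrightarrow>
             ((\<lambda>z. S z * K z / z) has_contour_integral (Q (pathfinish g) - Q (pathstart g) + S 0 * K 0 * j)) g"
    using contour_integral_simple_pole[OF _ _ SK_hol] by auto
  define w1 w2 w3 w4 where "w1 = Complex 0 R" and "w2 = Complex (-d) R" and "w3 = Complex (-d) (-R)" and "w4 = Complex 0 (-R)"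
  define Cp Cm where "Cp = part_circlepath 0 R (-pi/2) (pi/2)" and "Cm = part_circlepath 0 R (pi/2) (3*pi/2)"
  have "cos (3 * pi / 2) = 0" "sin (3 * pi / 2) = -1"
    using cos_3over2_pi sin_3over2_pi by simp_all
  hence ends [simp]: "pathstart Cp = w4" "pathfinish Cp = w1" "pathstart Cm = w1" "pathfinish Cm = w4"
    by (simp_all add: Cp_def Cm_def w1_def w4_def complex_eq_iff Re_exp Im_exp)
  have [simp]: "valid_path Cp" "valid_path Cm" by (simp_all add: Cp_def Cm_def)
  have Cp_im: "norm z = R \<and> Re z \<ge> 0" if "z \<in> path_image Cp" for z
    using half_circle_path_images(1)[OF R] that by (simp add: Cp_def)
  have Cm_im: "norm z = R \<and> Re z \<le> 0" if "z \<in> path_image Cm" for z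
    using half_circle_path_images(2)[OF R] that by (simp add: Cm_def)
  have L1_im: "z \<in> closed_segment w1 w2 \<longleftrightarrow> Im z = R \<and> -d \<le> Re z \<and> Re z \<le> 0" for z
    using d by (auto simp: w1_def w2_def closed_segment_same_Im closed_segment_eq_real_ivl)
  have L2_im: "z \<in> closed_segment w2 w3 \<longleftrightarrow> Re z = -d \<and> \<bar>Im z\<bar> \<le> R" for z
    using R by (auto simp: w2_def w3_def closed_segment_same_Re closed_segment_eq_real_ivl)
  have L3_im: "z \<in> closed_segment w3 w4 \<longleftrightarrow> Im z = -R \<and> -d \<le> Re z \<and> Re z \<le> 0" for z
    using d by (auto simp: w3_def w4_def closed_segment_same_Im closed_segment_eq_real_ivl)
  note L_im = L1_im L2_im L3_im
  define J where "J = Ln w1 - Ln w4"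
  have J: "J = \<i> * pi"
  proof -
    have "w1 = of_real R * \<i>" "w4 = of_real R * (-\<i>)" by (auto simp: w1_def w4_def complex_eq_iff)
    thus ?thesis
      using Ln_times_of_real[OF R, of "\<i>"] Ln_times_of_real[OF R, of "-\<i>"] by (simp add: J_def)
  qed
  \<comment> \<open>Left of the imaginary axis \<open>Ln\<close> itself would meet its branch cut;
    \<open>Ln (-z)\<close> is a primitive of 1 / z with the cut on the other side.\<close>
  have Ln_left: "((\<lambda>z. 1 / z) has_contour_integral (Ln (-pathfinish g) - Ln (-pathstart g))) g"
    if "valid_path g" "\<And>z. z \<in> path_image g \<Longrightarrow> Re z < 0 \<or> Im z \<noteq> 0" for g
  proof (rule contour_integral_primitive[of "path_image g"])
    fix z assume z: "z \<in> path_image g"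
    show "((\<lambda>z. Ln (-z)) has_field_derivative 1 / z) (at z within path_image g)"
      using that(2)[OF z] by (auto intro!: derivative_eq_intros simp: complex_nonpos_Reals_iff divide_inverse)
  qed (use that in auto)
  have one_Cp: "((\<lambda>z. 1 / z) has_contour_integral J) Cp"
  proof -
    have "((\<lambda>z. 1 / z) has_contour_integral (Ln (pathfinish Cp) - Ln (pathstart Cp))) Cp"
    proof (rule contour_integral_primitive[of "path_image Cp"])
      fix z assume "z \<in> path_image Cp"
      hence "Re z \<ge> 0" "norm z = R" using Cp_im by auto
      hence "z \<notin> \<real>\<^sub>\<le>\<^sub>0" using R by (auto simp: complex_nonpos_Reals_iff cmod_eq_Re)
      thus "(Ln has_field_derivative 1 / z) (at z within path_image Cp)"
        by (auto intro!: derivative_eq_intros simp: divide_inverse)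
    qed auto
    thus ?thesis by (simp add: J_def)
  qed
  have neg_w: "- w1 = w4" "- w4 = w1" by (auto simp: w1_def w4_def complex_eq_iff)
  have one_Cm: "((\<lambda>z. 1 / z) has_contour_integral J) Cm"
  proof -
    have "Re z < 0 \<or> Im z \<noteq> 0" if "z \<in> path_image Cm" for z
      using Cm_im[OF that] R by (auto simp: cmod_eq_Re)
    with Ln_left[of Cm] show ?thesis by (simp add: neg_w J_def)
  qed
  have one_L: "((\<lambda>z. 1 / z) has_contour_integral (Ln (-b) - Ln (-a))) (linepath a b)"
    if "(a, b) \<in> {(w1, w2), (w2, w3), (w3, w4)}" for a b
    using Ln_left[of "linepath a b"] that d R by (auto simp: L_im)
  have L_V: "closed_segment w1 w2 \<subseteq> V - {0}" "closed_segment w2 w3 \<subseteq> V - {0}" "closed_segment w3 w4 \<subseteq> V - {0}"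
    using d R by (auto simp: V_def L_im)
  have C_0: "path_image Cp \<subseteq> UNIV - {0}" "path_image Cm \<subseteq> UNIV - {0}" using Cp_im Cm_im R by force+
  have Cp_V: "path_image Cp \<subseteq> V - {0}"
  proof
    fix z assume "z \<in> path_image Cp"
    hence "norm z = R" "Re z \<ge> 0" using Cp_im by auto
    thus "z \<in> V - {0}" using abs_Im_le_cmod[of z] d R by (auto simp: V_def)
  qed
  define ICp where "ICp = P w1 - P w4 + q 0 * J"
  define ICm where "ICm = Q w4 - Q w1 + S 0 * J"
  have int_Cp: "((\<lambda>z. q z / z) has_contour_integral ICp) Cp"
    using P[OF _ Cp_V one_Cp] by (simp add: ICp_def)
  have int_Cm: "((\<lambda>z. S z * K z / z) has_contour_integral ICm) Cm"
    using Q[OF _ C_0(2) one_Cm] by (simp add: ICm_def)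
  define I where "I = (\<lambda>a b. (P b - P a + q 0 * (Ln (-b) - Ln (-a))) + (Q b - Q a + S 0 * (Ln (-b) - Ln (-a))))"
  have int_L: "((\<lambda>z. F z * K z / z) has_contour_integral I a b) (linepath a b)"
    if ab: "(a, b) \<in> {(w1, w2), (w2, w3), (w3, w4)}" for a b
  proof -
    have "path_image (linepath a b) \<subseteq> V - {0}" "path_image (linepath a b) \<subseteq> UNIV - {0}"
      using ab L_V by auto
    hence "((\<lambda>z. q z / z + S z * K z / z) has_contour_integral I a b) (linepath a b)"
      unfolding I_def using P[OF _ _ one_L[OF ab]] Q[OF _ _ one_L[OF ab]]
      by (intro has_contour_integral_add) auto
    thus ?thesis
      by (rule has_contour_integral_eq) (auto simp: q_def add_divide_distrib [symmetric] algebra_simps)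
  qed
  \<comment> \<open>From w1 to w4 on the left, three sides and half circle give the same integral J
    of 1 / z. The increments of Q cancel between them, those of P against the right half circle, and
    what remains is 2 J q(0) = 2 \<pi> i (F(0) - S(0)).\<close>
  have "I w1 w2 + I w2 w3 + I w3 w4 = P w4 - P w1 + q 0 * J + ICm"
    by (simp add: I_def ICm_def J_def neg_w algebra_simps)
  hence total: "2 * J * q 0 = ICp + (I w1 w2 + I w2 w3 + I w3 w4) - ICm"
    by (simp add: ICp_def algebra_simps)
  have A1: "A1 \<ge> 0"
    using right[of "of_real R"] R by (intro order.trans[OF _ right[of "of_real R"]]) auto
  have A2: "A2 \<ge> 0"
    using R by (intro order.trans[OF _ left[of "-of_real R"]]) auto
  have M0: "M \<ge> 0" using d R by (intro order.trans[OF _ M[of 0]]) auto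
  \<comment> \<open>On the circle |K(z) / z| = 4 exp(T Re z) (Re z)^2 / R^3, which is the weight in
    the hypotheses \<open>right\<close> and \<open>left\<close>.\<close>
  have circ: "norm (f z * K z / z) \<le> 4 * A / R ^ 3"
    if "norm z = R" "norm (f z) * exp (T * Re z) * (Re z)\<^sup>2 \<le> A" for f z A
  proof -
    have "norm (f z * K z / z) = (norm (f z) * exp (T * Re z) * (Re z)\<^sup>2) * (4 / R ^ 3)"
      using that R by (simp add: norm_mult norm_divide K_circle power_divide power_mult_distrib power2_eq_square power3_eq_cube)
    also have "\<dots> \<le> A * (4 / R ^ 3)" using R by (intro mult_right_mono that) auto
    finally show ?thesis by (simp add: mult_ac)
  qed
  \<comment> \<open>The hypotheses say nothing about Re z = 0; these two points are the finite
    exceptional set in the bounds for the half circles.\<close>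
  have wk: "z \<in> {w1, w4}" if "norm z = R" "Re z = 0" for z
  proof -
    have "\<bar>Im z\<bar> = R" using that by (simp add: cmod_eq_Im)
    thus ?thesis using that by (auto simp: w1_def w4_def complex_eq_iff abs_if split: if_splits)
  qed
  have b1: "norm ICp \<le> 4 * A1 / R ^ 3 * R * (pi / 2 - (-pi / 2))"
  proof (rule has_contour_integral_bound_part_circlepath_strong[of _ _ 0 R _ _ "{w1, w4}"])
    show "((\<lambda>z. q z / z) has_contour_integral ICp) (part_circlepath 0 R (-pi / 2) (pi / 2))"
      using int_Cp by (simp add: Cp_def)
    fix z assume "z \<in> path_image (part_circlepath 0 R (-pi / 2) (pi / 2)) - {w1, w4}"
    hence z: "norm z = R" "Re z > 0" using Cp_im[of z] wk[of z] by (auto simp: Cp_def order_le_less)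
    show "norm (q z / z) \<le> 4 * A1 / R ^ 3"
      unfolding q_def by (rule circ[where f = "\<lambda>z. F z - S z", OF z(1) right[OF z]])
  qed (use A1 R in auto)
  have b2: "norm ICm \<le> 4 * A2 / R ^ 3 * R * (3 * pi / 2 - pi / 2)"
  proof (rule has_contour_integral_bound_part_circlepath_strong[of _ _ 0 R _ _ "{w1, w4}"])
    show "((\<lambda>z. S z * K z / z) has_contour_integral ICm) (part_circlepath 0 R (pi / 2) (3 * pi / 2))"
      using int_Cm by (simp add: Cm_def)
    fix z assume "z \<in> path_image (part_circlepath 0 R (pi / 2) (3 * pi / 2)) - {w1, w4}"
    hence z: "norm z = R" "Re z < 0" using Cm_im[of z] wk[of z] by (auto simp: Cm_def order_le_less)
    show "norm (S z * K z / z) \<le> 4 * A2 / R ^ 3"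
      by (rule circ[where f = S, OF z(1) left[OF z]])
  qed (use A2 R in auto)
  \<comment> \<open>The lower bound r for |z| is R on the horizontal sides and d on the vertical
    one.\<close>
  have seg: "norm (F z * K z / z) \<le> 9 * M * exp (T * Re z) / r" 
    if "-d \<le> Re z" "Re z \<le> 0" "\<bar>Im z\<bar> \<le> R" "r > 0" "norm z \<ge> r" for z r
  proof -
    have "norm (F z * K z / z) = norm (F z) * norm (K z) / norm z" by (simp add: norm_mult norm_divide)
    also have "\<dots> \<le> M * (9 * exp (T * Re z)) / r"
      using that M0 by (intro frac_le mult_mono M K_left) auto
    finally show ?thesis by (simp add: mult_ac)
  qed
  have horiz: "norm (F z * K z / z) \<le> 9 * M / R" if "-d \<le> Re z" "Re z \<le> 0" "\<bar>Im z\<bar> = R" for z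
  proof -
    have "norm (F z * K z / z) \<le> 9 * M * exp (T * Re z) / R"
      using that R abs_Im_le_cmod[of z] by (intro seg) auto
    also have "\<dots> \<le> 9 * M * 1 / R"
      using that M0 R T by (intro divide_right_mono mult_left_mono) (auto simp: mult_nonneg_nonpos)
    finally show ?thesis by simp
  qed
  have b3: "norm (I w1 w2) \<le> 9 * M / R * norm (w2 - w1)"
  proof (rule has_contour_integral_bound_linepath[OF int_L])
    fix z assume "z \<in> closed_segment w1 w2"
    hence "-d \<le> Re z" "Re z \<le> 0" "\<bar>Im z\<bar> = R" using R by (simp_all add: L_im)
    thus "norm (F z * K z / z) \<le> 9 * M / R" by (rule horiz)
  qed (use M0 R in auto)
  have b5: "norm (I w3 w4) \<le> 9 * M / R * norm (w4 - w3)"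
  proof (rule has_contour_integral_bound_linepath[OF int_L])
    fix z assume "z \<in> closed_segment w3 w4"
    hence "-d \<le> Re z" "Re z \<le> 0" "\<bar>Im z\<bar> = R" using R by (simp_all add: L_im)
    thus "norm (F z * K z / z) \<le> 9 * M / R" by (rule horiz)
  qed (use M0 R in auto)
  have b4: "norm (I w2 w3) \<le> 9 * M * exp (-d * T) / d * norm (w3 - w2)"
  proof (rule has_contour_integral_bound_linepath[OF int_L])
    fix z assume "z \<in> closed_segment w2 w3"
    hence z: "Re z = -d" "\<bar>Im z\<bar> \<le> R" by (auto simp: L_im)
    show "norm (F z * K z / z) \<le> 9 * M * exp (-d * T) / d"
      using seg[of z d] z d abs_Re_le_cmod[of z] by (simp add: mult_ac)
  qed (use M0 d in auto)
  have "w2 - w1 = of_real (-d)" "w4 - w3 = of_real d" "w3 - w2 = of_real (-2 * R) * \<i>"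
    by (auto simp: w1_def w2_def w3_def w4_def complex_eq_iff)
  hence nw: "norm (w2 - w1) = d" "norm (w4 - w3) = d" "norm (w3 - w2) = 2 * R"
    using d R by (simp_all only: norm_mult norm_of_real norm_ii)
  have "2 * pi * norm (F 0 - S 0) = norm (2 * J * q 0)"
    by (simp add: J norm_mult q_def)
  also have "\<dots> \<le> norm ICp + (norm (I w1 w2) + norm (I w2 w3) + norm (I w3 w4)) + norm ICm"
    unfolding total by norm
  also have "\<dots> \<le> 4 * A1 / R ^ 3 * R * (pi / 2 - (-pi / 2)) + 
      (9 * M / R * d + 9 * M * exp (-d * T) / d * (2 * R) + 9 * M / R * d) + 4 * A2 / R ^ 3 * R * (3 * pi / 2 - pi / 2)"
    using b1 b2 b3 b4 b5 unfolding nw by (intro add_mono)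
  also have "\<dots> = 4 * pi * (A1 + A2) / R ^ 2 + 18 * M * d / R + 18 * M * R * exp (-d * T) / d"
    using R d by (simp add: field_simps power2_eq_square power3_eq_cube)
  finally show ?thesis .
qed

section \<open>Partial sums and tails of the Dirichlet series of
  \<open>mangoldt_diff\<close>\<close>

lemma sum_powr_le':
  assumes "0 < y"
  shows   "(\<Sum>n\<le>N. real n powr (y - 1)) \<le> real N powr y / y + real N powr (y - 1)"
proof (cases "y \<le> 1")
  case True
  with sum_powr_le[OF assms True, of N] show ?thesis by (simp add: add_increasing2)
next
  case False
  show ?thesis
  proof (induction N)
    case (Suc N)
    \<comment> \<open>For y > 1 the summand increases, so the increment of the integral up to N + 1
      pays only for the term n = N; the latest term stays outstanding as the extra summand of the
      bound.\<close>
    have "real N powr (y - 1) \<le> (real (Suc N) powr y - real N powr y) / y"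
    proof (cases "N = 0")
      case N: False
      have "\<exists>z. real N < z \<and> z < real N + 1 \<and> (real N + 1) powr y - real N powr y =
              (real N + 1 - real N) * (y * z powr (y - 1))"
        using assms N by (intro MVT2) (auto intro!: derivative_eq_intros)
      then obtain z where z: "real N < z" "z < real N + 1"
        "(real N + 1) powr y - real N powr y = y * z powr (y - 1)" by auto
      have "real N powr (y - 1) \<le> z powr (y - 1)"
        using z assms False by (intro powr_mono2) auto
      thus ?thesis using z assms by (simp add: field_simps)
    qed (use assms in auto)
    with Suc show ?case by (simp add: diff_divide_distrib)
  qed (use assms in auto)
qed

definition mangoldt_partial :: "nat \<Rightarrow> complex \<Rightarrow> complex" where
  "mangoldt_partial N z = (\<Sum>n\<le>N. (mangoldt n - 1) * of_nat n powr (-(1 + z)))"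

lemma norm_mangoldt_diff_one_le:
  assumes "n > 0"
  shows   "norm (mangoldt n - 1 :: complex) \<le> 1 + ln (real n)"
  using norm_triangle_ineq4[of "mangoldt n :: complex" 1] mangoldt_le[of n] assms by simp

text \<open>Integral test for |\<Lambda>(n) - 1| \<le> 1 + ln n. With x = Re z, integrating (1 + ln
  u) u^(-1-x) by parts gives -\<phi>; the logarithm is what produces 1 / x^2, the singularity that
  the squared kernel absorbs.\<close>

lemma norm_mangoldt_diff_minus_partial_le:
  assumes N: "N > 0" and z: "Re z > 0"
  shows   "norm (mangoldt_diff (1 + z) - mangoldt_partial N z) \<le>
             real N powr (-Re z) * ((1 + ln (real N)) / Re z + 1 / (Re z)\<^sup>2)"
proof -
  define x where "x = Re z"
  define h where "h = (\<lambda>u::real. (1 + ln u) * u powr (-1 - x))"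
  define \<phi> where "\<phi> = (\<lambda>u::real. u powr (-x) * ((1 + ln u) / x + 1 / x\<^sup>2))"
  have x: "x > 0" using z by (simp add: x_def)
  have deriv_\<phi>: "(\<phi> has_real_derivative - h u) (at u)" if "u \<ge> real N" for u
  proof -
    have u: "u > 0" using that N by linarith
    have [simp]: "u powr (-x) / u = u powr (-1 - x)" using u by (simp add: powr_diff powr_minus field_simps)
    have "(\<phi> has_real_derivative
             (-x * u powr (-x - 1)) * ((1 + ln u) / x + 1 / x\<^sup>2) + u powr (-x) * (1 / u / x)) (at u)"
      unfolding \<phi>_def using u x by (auto intro!: derivative_eq_intros)
    also have "(-x * u powr (-x - 1)) * ((1 + ln u) / x + 1 / x\<^sup>2) + u powr (-x) * (1 / u / x) = - h u"
    proof -
      have e: "u powr (-x) * (1 / u / x) = u powr (-1 - x) / x" by (simp flip: divide_divide_eq_left)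
      have e': "-x - 1 = -1 - x" by simp
      show ?thesis unfolding e e' h_def using x by (simp add: field_simps power2_eq_square)
    qed
    finally show ?thesis .
  qed
  have deriv_h: "(h has_real_derivative u powr (-2 - x) * (1 - (1 + x) * (1 + ln u))) (at u)" if "u > 0" for u
  proof -
    have e1: "(1 / u) * u powr (-1 - x) = u powr (-2 - x)"
      using that powr_diff[of u "-1 - x" 1] by simp
    have e2: "-1 - x - 1 = -2 - x" by simp
    have "(h has_real_derivative (1 / u) * u powr (-1 - x) + (-1 - x) * u powr (-1 - x - 1) * (1 + ln u)) (at u)"
      unfolding h_def by (rule derivative_eq_intros refl that)+ (use that in simp)
    thus ?thesis unfolding e1 e2 by (simp add: algebra_simps)
  qed
  have h_anti: "h v \<le> h u" if "real N \<le> u" "u \<le> v" for u v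
  proof (rule DERIV_nonpos_imp_nonincreasing[OF that(2)])
    fix w assume w: "u \<le> w" "w \<le> v"
    have w1: "w \<ge> 1" using w that N by linarith
    have "(1 + x) * (1 + ln w) \<ge> 1 * 1" using w1 x by (intro mult_mono) auto
    hence "w powr (-2 - x) * (1 - (1 + x) * (1 + ln w)) \<le> 0" by (intro mult_nonneg_nonpos) auto
    thus "\<exists>y. (h has_real_derivative y) (at w) \<and> y \<le> 0" using deriv_h[of w] w1 by auto
  qed
  have partial: "norm (mangoldt_partial M z - mangoldt_partial N z) \<le> \<phi> N" if "M \<ge> N" for M
  proof -
    have "{..M} - {..N} = {N<..M}" by auto
    hence "mangoldt_partial M z - mangoldt_partial N z = 
            (\<Sum>n\<in>{N<..M}. (mangoldt n - 1) * of_nat n powr (-(1 + z)))"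
      unfolding mangoldt_partial_def using that by (subst sum_diff [symmetric]) auto
    also have "norm \<dots> \<le> (\<Sum>n\<in>{N<..M}. h (real n))"
    proof (rule sum_norm_le)
      fix n assume "n \<in> {N<..M}"
      thus "norm ((mangoldt n - 1) * of_nat n powr (-(1 + z)) :: complex) \<le> h (real n)"
        using norm_mangoldt_diff_one_le[of n]
        by (auto simp: norm_mult norm_of_nat_powr h_def x_def intro!: mult_right_mono)
    qed
    also have "\<dots> \<le> \<phi> (real N) - \<phi> (real M)"
      using that by (intro sum_le_antiderivative deriv_\<phi> h_anti) auto
    also have "\<dots> \<le> \<phi> (real N)" using that N x by (auto simp: \<phi>_def)
    finally show ?thesis by simp
  qed
  have "(\<lambda>M. mangoldt_partial M z) \<longlonglongrightarrow> mangoldt_diff (1 + z)"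
    using sums_mangoldt_diff[of "1 + z"] z by (simp add: sums_def_le mangoldt_partial_def)
  hence "(\<lambda>M. norm (mangoldt_partial M z - mangoldt_partial N z)) \<longlonglongrightarrow> norm (mangoldt_diff (1 + z) - mangoldt_partial N z)"
    by (intro tendsto_intros)
  thus ?thesis
    using partial by (intro LIMSEQ_le_const2[where X = "\<lambda>M. norm (mangoldt_partial M z - mangoldt_partial N z)"])
      (auto simp: \<phi>_def x_def)
qed

lemma norm_mangoldt_partial_le:
  assumes N: "N > 0" and z: "Re z < 0"
  shows   "norm (mangoldt_partial N z) \<le>
             (1 + ln (real N)) * (real N powr (-Re z) / (-Re z) + real N powr (-Re z - 1))"
proof -
  have "norm (mangoldt_partial N z) \<le> (\<Sum>n\<le>N. (1 + ln (real N)) * real n powr (-Re z - 1))"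
    unfolding mangoldt_partial_def
  proof (rule sum_norm_le)
    fix n assume n: "n \<in> {..N}"
    show "norm ((mangoldt n - 1) * of_nat n powr (-(1 + z)) :: complex) \<le> (1 + ln (real N)) * real n powr (-Re z - 1)"
    proof (cases "n = 0")
      case False
      have "1 + ln (real n) \<le> 1 + ln (real N)" using False n by auto
      hence "norm (mangoldt n - 1 :: complex) \<le> 1 + ln (real N)"
        using norm_mangoldt_diff_one_le[of n] False by linarith
      moreover have "Re (-(1 + z)) = -Re z - 1" by simp
      ultimately show ?thesis
        unfolding norm_mult norm_of_nat_powr by (simp only:) (rule mult_right_mono, auto)
    qed auto
  qed
  also have "\<dots> = (1 + ln (real N)) * (\<Sum>n\<le>N. real n powr (-Re z - 1))" by (simp add: sum_distrib_left)
  also have "\<dots> \<le> (1 + ln (real N)) * (real N powr (-Re z) / (-Re z) + real N powr (-Re z - 1))"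
    using sum_powr_le'[of "-Re z" N] z N by (intro mult_left_mono) auto
  finally show ?thesis .
qed

definition mangoldt_mean :: "nat \<Rightarrow> real" where
  "mangoldt_mean N = (\<Sum>n\<le>N. (mangoldt n - 1) / real n)"

text \<open>The constant is the value of \<open>mangoldt_diff\<close> at 1. The three parts of the
  contour bound have the orders T / R, 1 / R (the powers R^(1/4) and R^(-1/4) cancel) and R^(3/2)
  exp(-const T^(1/4)), so the first one decides.\<close>

lemma mangoldt_mean_asymp:
  "\<exists>c. (\<lambda>N. mangoldt_mean N - c) \<in> O(\<lambda>N. 1 / ln (real N) ^ 2)"
proof -
  obtain \<kappa> M where \<kappa>: "\<kappa> > 0" "\<kappa> \<le> 1/40" and M: "M > 0" and zfr:
     "\<And>R s. R \<ge> 2 \<Longrightarrow> \<bar>Im s\<bar> \<le> R \<Longrightarrow> Re s \<ge> 1 - \<kappa> * R powr (-1/4) \<Longrightarrow> zreg s \<noteq> 0"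
     "\<And>R s. R \<ge> 2 \<Longrightarrow> \<bar>Im s\<bar> \<le> R \<Longrightarrow> Re s \<ge> 1 - \<kappa> * R powr (-1/4) \<Longrightarrow> Re s \<le> 1 \<Longrightarrow>
          norm (mangoldt_diff s) \<le> M * R powr (1/4)"
    using zero_free_region by metis
  \<comment> \<open>the contour bound for \<open>T = ln N\<close>, \<open>R = T ^ 3\<close> and \<open>d = \<kappa> * (R + 1) powr (-1/4) / 2\<close>\<close>
  define B where "B = (\<lambda>N.
     4 * pi * (((1 + ln (real N)) * ln (real N) ^ 3 + 1) +
       (1 + ln (real N)) * (ln (real N) ^ 3 + (ln (real N) ^ 3) ^ 2 / real N)) / (ln (real N) ^ 3) ^ 2
     + 18 * (M * (ln (real N) ^ 3 + 1) powr (1/4)) *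
       (\<kappa> * (ln (real N) ^ 3 + 1) powr (-1/4) / 2) / (ln (real N) ^ 3)
     + 18 * (M * (ln (real N) ^ 3 + 1) powr (1/4)) * (ln (real N) ^ 3) *
       exp (-(\<kappa> * (ln (real N) ^ 3 + 1) powr (-1/4) / 2) * ln (real N)) /
       (\<kappa> * (ln (real N) ^ 3 + 1) powr (-1/4) / 2))"
  have "B \<in> O(\<lambda>N. 1 / ln (real N) ^ 2)"
    unfolding B_def
    by (intro sum_in_bigo) (use \<kappa>(1) M in real_asymp)+
  moreover have "(\<lambda>N. mangoldt_mean N - Re (mangoldt_diff 1)) \<in> O(B)"
  proof (rule bigoI[of _ 1])
    have "eventually (\<lambda>N. ln (real N) \<ge> 2) sequentially" by real_asymp
    thus "eventually (\<lambda>N. norm (mangoldt_mean N - Re (mangoldt_diff 1)) \<le> 1 * norm (B N)) sequentially"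
      using eventually_gt_at_top[of 0]
    proof eventually_elim
      case (elim N)
      define T where "T = ln (real N)"
      define R where "R = T ^ 3"
      \<comment> \<open>The width is taken at R + 1 because holomorphy is required on an open set
        around the contour, which reaches height R; halving it leaves the same room on the
        left.\<close>
      define d' where "d' = \<kappa> * (R + 1) powr (-1/4)"
      define d where "d = d' / 2"
      have T: "T \<ge> 2" using elim by (simp add: T_def)
      have R: "R \<ge> 2" using power_mono[of 2 T 3] T by (simp add: R_def)
      have N: "real N = exp T" using elim by (simp add: T_def)
      have "(R + 1) powr (-1/4) \<le> (R + 1) powr 0" using R by (intro powr_mono) auto
      hence d': "0 < d'" "d' \<le> 1/40"
        using \<kappa> R mult_mono[OF \<kappa>(2), of "(R + 1) powr (-1/4)" 1] by (auto simp: d'_def)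
      have powN: "real N powr u = exp (T * u)" for u
        using elim by (simp add: powr_def T_def mult.commute)
      have "2 * pi * norm (mangoldt_diff (1 + 0) - mangoldt_partial N 0) \<le>
              4 * pi * (((1 + T) * R + 1) + (1 + T) * (R + R ^ 2 / real N)) / R ^ 2 + 
              18 * (M * (R + 1) powr (1/4)) * d / R + 18 * (M * (R + 1) powr (1/4)) * R * exp (-d * T) / d"
      proof (rule newman_contour_bound[where R' = "R + 1" and d' = d'])
        show "(\<lambda>z. mangoldt_diff (1 + z)) holomorphic_on {z. - d' < Re z \<and> \<bar>Im z\<bar> < R + 1}"
        proof -
          define A where "A = {s. Re s > 1 - d' \<and> \<bar>Im s\<bar> < R + 1}"
          have "A = {s. Re s > 1 - d'} \<inter> {s. Im s > -(R+1)} \<inter> {s. Im s < R + 1}" by (auto simp: A_def)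
          hence "open A" by (auto intro!: open_Int open_halfspace_Re_gt open_halfspace_Im_gt open_halfspace_Im_lt)
          hence "mangoldt_diff holomorphic_on A"
          proof (rule holomorphic_mangoldt_diff, intro conjI)
            fix s assume "s \<in> A"
            thus "Re s > 0" "zreg s \<noteq> 0"
              using d' R zfr(1)[of "R + 1" s] by (auto simp: A_def d'_def)
          qed
          hence "(mangoldt_diff \<circ> (\<lambda>z. 1 + z)) holomorphic_on {z. - d' < Re z \<and> \<bar>Im z\<bar> < R + 1}"
            by (intro holomorphic_on_compose holomorphic_intros)
               (auto elim!: holomorphic_on_subset simp: A_def)
          thus ?thesis by (simp add: o_def)
        qed
        show "mangoldt_partial N holomorphic_on UNIV"
          unfolding mangoldt_partial_def by (intro holomorphic_intros)
      next
        fix z assume z: "norm z = R" "Re z > 0"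
        have "norm (mangoldt_diff (1 + z) - mangoldt_partial N z) * exp (T * Re z) * (Re z)\<^sup>2 \<le>
              (real N powr (-Re z) * ((1 + T) / Re z + 1 / (Re z)\<^sup>2)) * exp (T * Re z) * (Re z)\<^sup>2"
          using norm_mangoldt_diff_minus_partial_le[of N z] elim z
          by (intro mult_right_mono) (auto simp: T_def)
        also have "\<dots> = (1 + T) * Re z + 1"
          using z by (simp add: powN exp_minus field_simps power2_eq_square)
        also have "\<dots> \<le> (1 + T) * R + 1"
          using z complex_Re_le_cmod[of z] T by (intro add_mono mult_left_mono) auto
        finally show "norm (mangoldt_diff (1 + z) - mangoldt_partial N z) * exp (T * Re z) * (Re z)\<^sup>2 \<le> \<dots>" .
      next
        fix z assume z: "norm z = R" "Re z < 0"
        define y where "y = -Re z"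
        have y: "y > 0" "y \<le> R" using z abs_Re_le_cmod[of z] by (auto simp: y_def)
        have "norm (mangoldt_partial N z) * exp (T * Re z) * (Re z)\<^sup>2 \<le>
              ((1 + T) * (real N powr y / y + real N powr (y - 1))) * exp (T * Re z) * (Re z)\<^sup>2"
          using norm_mangoldt_partial_le[of N z] elim z
          by (intro mult_right_mono) (auto simp: T_def y_def)
        also have "real N powr (y - 1) = real N powr y / real N" using elim by (simp add: powr_diff)
        also have "(1 + T) * (real N powr y / y + real N powr y / real N) * exp (T * Re z) * (Re z)\<^sup>2 = 
                     (1 + T) * (y + y ^ 2 / real N)"
        proof -
          have "exp (T * Re z) = 1 / real N powr y" by (simp add: powN y_def exp_minus field_simps)
          moreover have "(Re z)\<^sup>2 = y\<^sup>2" by (simp add: y_def)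
          ultimately show ?thesis using y elim by (simp add: field_simps power2_eq_square)
        qed
        also have "\<dots> \<le> (1 + T) * (R + R ^ 2 / real N)"
          using y T by (intro mult_left_mono add_mono divide_right_mono power_mono) auto
        finally show "norm (mangoldt_partial N z) * exp (T * Re z) * (Re z)\<^sup>2 \<le> \<dots>" .
      next
        fix z assume z: "-d \<le> Re z" "Re z \<le> 0" "\<bar>Im z\<bar> \<le> R"
        show "norm (mangoldt_diff (1 + z)) \<le> M * (R + 1) powr (1/4)"
          using z R d' by (intro zfr(2)) (auto simp: d_def d'_def)
      qed (use R T d' in \<open>auto simp: d_def\<close>)
      also have "\<dots> = B N"
        unfolding B_def d_def d'_def R_def T_def by simp
      finally have "2 * pi * norm (mangoldt_diff 1 - mangoldt_partial N 0) \<le> B N" by simp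
      moreover have "1 * norm (mangoldt_diff 1 - mangoldt_partial N 0) \<le> 2 * pi * norm (mangoldt_diff 1 - mangoldt_partial N 0)"
        using pi_gt3 by (intro mult_right_mono) auto
      moreover have "mangoldt_partial N 0 = of_real (mangoldt_mean N)"
        by (simp add: mangoldt_partial_def mangoldt_mean_def powr_minus divide_inverse cong: sum.cong)
      moreover have "\<bar>Re (mangoldt_diff 1 - of_real (mangoldt_mean N))\<bar> \<le> norm (mangoldt_diff 1 - of_real (mangoldt_mean N))"
        by (rule abs_Re_le_cmod)
      ultimately have "\<bar>Re (mangoldt_diff 1) - mangoldt_mean N\<bar> \<le> B N" by simp
      thus ?case by simp
    qed
  qed
  ultimately show ?thesis using landau_o.big_trans by blast
qed

section \<open>The prime counting function\<close>

text \<open>Split at the square root of N: beyond it ln n \<ge> ln N / 2, which costs a factor 2^k,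
  and up to it there are few terms, each bounded. Finitely many initial terms, where the hypothesis
  gives nothing, go into \<open>K0\<close>.\<close>

lemma sum_bigo_inverse_ln_power:
  fixes f :: "nat \<Rightarrow> real"
  assumes "f \<in> O(\<lambda>n. 1 / ln (real n) ^ k)"
  shows   "(\<lambda>N. \<Sum>n\<le>N. f n) \<in> O(\<lambda>N. real N / ln (real N) ^ k)"
proof -
  from assms obtain C where C: "C > 0" "eventually (\<lambda>n. norm (f n) \<le> C * norm (1 / ln (real n) ^ k)) at_top"
    by (elim landau_o.bigE)
  from C(2) obtain n0 where n0: "\<And>n. n \<ge> n0 \<Longrightarrow> norm (f n) \<le> C * norm (1 / ln (real n) ^ k)"
    by (auto simp: eventually_at_top_linorder)
  define m where "m = max n0 2"
  have fm: "\<bar>f n\<bar> \<le> C / ln (real n) ^ k" if "n \<ge> m" for n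
    using n0[of n] that by (simp add: m_def)
  define K0 where "K0 = (\<Sum>n<m. \<bar>f n\<bar>)"
  have "(\<lambda>N. K0 + (sqrt (real N) + 1) * (C / ln 2 ^ k) + (real N + 1) * (C * 2 ^ k / ln (real N) ^ k)) \<in>
          O(\<lambda>N. real N / ln (real N) ^ k)"
    by (intro sum_in_bigo) real_asymp+
  moreover have "(\<lambda>N. \<Sum>n\<le>N. f n) \<in> 
      O(\<lambda>N. K0 + (sqrt (real N) + 1) * (C / ln 2 ^ k) + (real N + 1) * (C * 2 ^ k / ln (real N) ^ k))"
  proof (rule bigoI[of _ 1])
    show "eventually (\<lambda>N. norm (\<Sum>n\<le>N. f n) \<le> 1 * norm (K0 + (sqrt (real N) + 1) * (C / ln 2 ^ k) + (real N + 1) * (C * 2 ^ k / ln (real N) ^ k))) at_top"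
      using eventually_ge_at_top[of 2]
    proof eventually_elim
      case (elim N)
      define s where "s = nat \<lfloor>sqrt (real N)\<rfloor>"
      have s: "real s \<le> sqrt (real N)" by (simp add: s_def)
      have bound: "\<bar>f n\<bar> \<le> (if n < m then \<bar>f n\<bar> else 0) + (if n \<le> s then C / ln 2 ^ k else 0) + C * 2 ^ k / ln (real N) ^ k"
        for n
      proof -
        have nonneg: "C * 2 ^ k / ln (real N) ^ k \<ge> 0" "C / ln 2 ^ k \<ge> 0" using C elim by auto
        consider "n < m" | "n \<ge> m" "n \<le> s" | "n \<ge> m" "n > s" by linarith
        thus ?thesis
        proof cases
          case 2
          have "\<bar>f n\<bar> \<le> C / ln (real n) ^ k" using 2 by (intro fm)
          also have "\<dots> \<le> C / ln 2 ^ k"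
            using 2 C by (intro divide_left_mono power_mono mult_pos_pos zero_less_power) (auto simp: m_def)
          finally show ?thesis using 2 nonneg by auto
        next
          case 3
          have "real n \<ge> sqrt (real N)" using 3 by (simp add: s_def) linarith
          hence "ln (real n) \<ge> ln (sqrt (real N))" using elim 3 by (subst ln_le_cancel_iff) (auto simp: m_def)
          hence ln: "ln (real n) \<ge> ln (real N) / 2" using elim by (simp add: ln_sqrt)
          have "\<bar>f n\<bar> \<le> C / ln (real n) ^ k" using 3 by (intro fm)
          also have "\<dots> \<le> C / (ln (real N) / 2) ^ k"
            using 3 C elim ln by (intro divide_left_mono power_mono mult_pos_pos zero_less_power) (auto simp: m_def)
          finally show ?thesis using 3 nonneg by (simp add: power_divide)
        qed (use nonneg in auto)
      qed
      have "norm (\<Sum>n\<le>N. f n) \<le> (\<Sum>n\<le>N. \<bar>f n\<bar>)" by (simp add: sum_abs)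
      also have "\<dots> \<le> (\<Sum>n\<le>N. (if n < m then \<bar>f n\<bar> else 0) + (if n \<le> s then C / ln 2 ^ k else 0) + C * 2 ^ k / ln (real N) ^ k)"
        by (intro sum_mono bound)
      also have "\<dots> = (\<Sum>n\<in>{..N} \<inter> {n. n < m}. \<bar>f n\<bar>) + (\<Sum>n\<in>{..N} \<inter> {n. n \<le> s}. C / ln 2 ^ k) + (\<Sum>n\<le>N. C * 2 ^ k / ln (real N) ^ k)"
        by (simp only: sum.distrib sum.inter_restrict [OF finite_atMost] mem_Collect_eq)
      also have "(\<Sum>n\<in>{..N} \<inter> {n. n < m}. \<bar>f n\<bar>) \<le> K0"
        unfolding K0_def by (intro sum_mono2) auto
      also have "(\<Sum>n\<in>{..N} \<inter> {n. n \<le> s}. C / ln 2 ^ k) \<le> (\<Sum>n\<le>s. C / ln 2 ^ k)"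
        using C by (intro sum_mono2) auto
      also have "(\<Sum>n\<le>s. C / ln 2 ^ k) = (real s + 1) * (C / ln 2 ^ k)" by simp
      also have "\<dots> \<le> (sqrt (real N) + 1) * (C / ln 2 ^ k)"
        using s C by (intro mult_right_mono) auto
      also have "(\<Sum>n\<le>N. C * 2 ^ k / ln (real N) ^ k) = (real N + 1) * (C * 2 ^ k / ln (real N) ^ k)" by simp
      finally show ?case by simp
    qed
  qed
  ultimately show ?thesis using landau_o.big_trans by blast
qed

text \<open>\<psi>(N) - N for Chebyshev's function \<psi>.\<close>

definition psi_diff :: "nat \<Rightarrow> real" where
  "psi_diff N = (\<Sum>n=1..N. mangoldt n - 1)"

text \<open>Summation by parts. The constant cancels because n < N runs over exactly N indices, 0
  included; with c the limit of \<open>mangoldt_mean\<close>, both parts become small.\<close>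

lemma psi_diff_abel:
  "psi_diff N = real N * (mangoldt_mean N - c) - (\<Sum>n<N. mangoldt_mean n - c)"
proof (induction N)
  case (Suc N)
  have "psi_diff (Suc N) = psi_diff N + (mangoldt (Suc N) - 1)" by (simp add: psi_diff_def)
  moreover have "real (Suc N) * mangoldt_mean (Suc N) = real (Suc N) * mangoldt_mean N + (mangoldt (Suc N) - 1)"
    by (simp add: mangoldt_mean_def field_simps)
  ultimately show ?case using Suc by (simp add: algebra_simps)
qed (simp_all add: psi_diff_def)

lemma psi_diff_asymp: "psi_diff \<in> O(\<lambda>N. real N / ln (real N) ^ 2)"
proof -
  obtain c where c: "(\<lambda>N. mangoldt_mean N - c) \<in> O(\<lambda>N. 1 / ln (real N) ^ 2)"
    using mangoldt_mean_asymp by blast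
  have "(\<lambda>N. real N * (mangoldt_mean N - c)) \<in> O(\<lambda>N. real N * (1 / ln (real N) ^ 2))"
    by (intro landau_o.big.mult c) auto
  hence 1: "(\<lambda>N. real N * (mangoldt_mean N - c)) \<in> O(\<lambda>N. real N / ln (real N) ^ 2)" by simp
  have 2: "(\<lambda>N. \<Sum>n\<le>N. mangoldt_mean n - c) \<in> O(\<lambda>N. real N / ln (real N) ^ 2)"
    by (rule sum_bigo_inverse_ln_power[OF c])
  have 3: "(\<lambda>N. mangoldt_mean N - c) \<in> O(\<lambda>N. real N / ln (real N) ^ 2)"
    by (rule landau_o.big_trans[OF c]) real_asymp
  have "(\<lambda>N. real N * (mangoldt_mean N - c) - ((\<Sum>n\<le>N. mangoldt_mean n - c) - (mangoldt_mean N - c)))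
                    \<in> O(\<lambda>N. real N / ln (real N) ^ 2)"
    by (rule sum_in_bigo(2)[OF 1 sum_in_bigo(2)[OF 2 3]])
  also have "(\<lambda>N. real N * (mangoldt_mean N - c) - ((\<Sum>n\<le>N. mangoldt_mean n - c) - (mangoldt_mean N - c))) = psi_diff"
    by (intro ext) (simp add: psi_diff_abel[of _ c] flip: lessThan_Suc_atMost)
  finally show ?thesis .
qed

text \<open>Summation by parts from n = 2, whereas \<open>psi_diff\<close> counts from 1; the
  boundary term -\<open>psi_diff 1\<close> / ln 2 equals 1 / ln 2.\<close>

lemma sum_mangoldt_over_ln_abel:
  assumes "N \<ge> 2"
  shows   "(\<Sum>n=2..N. (mangoldt n - 1) / ln (real n)) =
             psi_diff N / ln (real N) + (\<Sum>n=2..<N. psi_diff n * (1 / ln (real n) - 1 / ln (real n + 1))) + 1 / ln 2"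
  using assms
proof (induction N rule: dec_induct)
  case base
  have "psi_diff 2 = -1 + (mangoldt 2 - 1)" 
    by (simp add: psi_diff_def numeral_2_eq_2)
  thus ?case by (simp add: field_simps)
next
  case (step N)
  have "psi_diff (Suc N) = psi_diff N + (mangoldt (Suc N) - 1)" by (simp add: psi_diff_def)
  thus ?case
    using step by (simp add: add_divide_distrib diff_divide_distrib right_diff_distrib add_ac)
qed

text \<open>The weights 1 / ln n - 1 / ln (n + 1) are of order 1 / (n ln^2 n), so against
  \<open>psi_diff\<close> the summands are O(1 / ln^4 n), within the required O(1 / ln^3 n).\<close>

lemma sum_mangoldt_over_ln_asymp:
  "(\<lambda>N. \<Sum>n=2..N. (mangoldt n - 1) / ln (real n)) \<in> O(\<lambda>N. real N / ln (real N) ^ 3)"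
proof -
  define f where "f = (\<lambda>n. if n < 2 then 0 else psi_diff n * (1 / ln (real n) - 1 / ln (real n + 1)))"
  have "(\<lambda>n. psi_diff n * (1 / ln (real n) - 1 / ln (real n + 1))) \<in>
           O(\<lambda>n. real n / ln (real n) ^ 2 * (1 / (real n * ln (real n) ^ 2)))"
    by (intro landau_o.big.mult psi_diff_asymp) real_asymp
  also have "(\<lambda>n. real n / ln (real n) ^ 2 * (1 / (real n * ln (real n) ^ 2))) \<in> O(\<lambda>n. 1 / ln (real n) ^ 3)"
    by real_asymp
  also have "(\<lambda>n. psi_diff n * (1 / ln (real n) - 1 / ln (real n + 1))) \<in> O(\<lambda>n. 1 / ln (real n) ^ 3) \<longleftrightarrow>
             f \<in> O(\<lambda>n. 1 / ln (real n) ^ 3)"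
    by (intro landau_o.big.in_cong eventually_mono[OF eventually_ge_at_top[of 2]]) (auto simp: f_def)
  finally have f: "f \<in> O(\<lambda>n. 1 / ln (real n) ^ 3)" .
  have "(\<lambda>N. psi_diff N * (1 / ln (real N))) \<in> O(\<lambda>N. real N / ln (real N) ^ 2 * (1 / ln (real N)))"
    by (intro landau_o.big.mult psi_diff_asymp) auto
  also have "(\<lambda>N. real N / ln (real N) ^ 2 * (1 / ln (real N))) = (\<lambda>N. real N / ln (real N) ^ 3)"
    by (simp add: power2_eq_square power3_eq_cube mult_ac)
  finally have 1: "(\<lambda>N. psi_diff N * (1 / ln (real N))) \<in> O(\<lambda>N. real N / ln (real N) ^ 3)" .
  have 2: "(\<lambda>N. \<Sum>n\<le>N. f n) \<in> O(\<lambda>N. real N / ln (real N) ^ 3)"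
    by (rule sum_bigo_inverse_ln_power[OF f])
  have 3: "f \<in> O(\<lambda>N. real N / ln (real N) ^ 3)" by (rule landau_o.big_trans[OF f]) real_asymp
  have 4: "(\<lambda>N. 1 / ln 2) \<in> O(\<lambda>N. real N / ln (real N) ^ 3)" by real_asymp
  have "(\<lambda>N. psi_diff N * (1 / ln (real N)) + ((\<Sum>n\<le>N. f n) - f N) + 1 / ln 2) \<in> O(\<lambda>N. real N / ln (real N) ^ 3)"
    by (intro sum_in_bigo 1 2 3 4)
  also have "?this \<longleftrightarrow> ?thesis"
  proof (intro landau_o.big.in_cong eventually_mono[OF eventually_ge_at_top[of 2]])
    fix N :: nat assume N: "N \<ge> 2"
    have "(\<Sum>n\<le>N. f n) - f N = (\<Sum>n<N. f n)" by (simp flip: lessThan_Suc_atMost)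
    also have "\<dots> = (\<Sum>n=2..<N. psi_diff n * (1 / ln (real n) - 1 / ln (real n + 1)))"
      by (intro sum.mono_neutral_cong_right) (auto simp: f_def)
    finally show "psi_diff N * (1 / ln (real N)) + ((\<Sum>n\<le>N. f n) - f N) + 1 / ln 2 = (\<Sum>n=2..N. (mangoldt n - 1) / ln (real n))"
      using N by (simp add: sum_mangoldt_over_ln_abel)
  qed
  finally show ?thesis .
qed

text \<open>The function g(x) = x / ln x + x / ln^2 x, the first two terms of the logarithmic
  integral, has g'(x) = 1 / ln x - 2 / ln^3 x. Hence its increments, which telescope, agree with 1 /
  ln n up to O(1 / ln^3 n).\<close>

lemma sum_inverse_ln_asymp:
  "(\<lambda>N. (\<Sum>n=2..N. 1 / ln (real n)) - (real N / ln (real N) + real N / ln (real N) ^ 2)) \<in> O(\<lambda>N. real N / ln (real N) ^ 3)"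
proof -
  define g where "g = (\<lambda>x::real. x / ln x + x / ln x ^ 2)"
  \<comment> \<open>At n = 2 the increment would involve g(1), where ln vanishes; this index enters
    through the constant \<open>1 / ln 2 - g 2\<close>.\<close>
  define f where "f = (\<lambda>n. if n \<le> 2 then 0 else 1 / ln (real n) - (g (real n) - g (real n - 1)))"
  have "(\<lambda>n. 1 / ln (real n) - (g (real n) - g (real n - 1))) \<in> O(\<lambda>n. 1 / ln (real n) ^ 3)"
    unfolding g_def by real_asymp
  also have "?this \<longleftrightarrow> f \<in> O(\<lambda>n. 1 / ln (real n) ^ 3)"
    by (intro landau_o.big.in_cong eventually_mono[OF eventually_gt_at_top[of 2]]) (auto simp: f_def)
  finally have "(\<lambda>N. \<Sum>n\<le>N. f n) \<in> O(\<lambda>N. real N / ln (real N) ^ 3)"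
    by (rule sum_bigo_inverse_ln_power)
  moreover have "(\<lambda>N. 1 / ln 2 - g 2) \<in> O(\<lambda>N. real N / ln (real N) ^ 3)" by real_asymp
  ultimately have "(\<lambda>N. (\<Sum>n\<le>N. f n) + (1 / ln 2 - g 2)) \<in> O(\<lambda>N. real N / ln (real N) ^ 3)"
    by (rule sum_in_bigo)
  also have "?this \<longleftrightarrow> ?thesis"
  proof (intro landau_o.big.in_cong eventually_mono[OF eventually_ge_at_top[of 2]])
    fix N :: nat assume "N \<ge> 2"
    thus "(\<Sum>n\<le>N. f n) + (1 / ln 2 - g 2) = (\<Sum>n=2..N. 1 / ln (real n)) - (real N / ln (real N) + real N / ln (real N) ^ 2)"
    proof (induction N rule: dec_induct)
      case base
      thus ?case by (simp add: f_def g_def eval_nat_numeral)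
    next
      case (step N)
      have "f (Suc N) = 1 / ln (real (Suc N)) - (g (real (Suc N)) - g (real N))"
        using step by (simp add: f_def)
      thus ?case using step by (simp add: g_def)
    qed
  qed
  finally show ?thesis .
qed

section \<open>From prime powers to primes\<close>

definition prime_count :: "nat \<Rightarrow> nat" where
  "prime_count N = card {p. prime p \<and> p \<le> N}"

text \<open>Such a number is p^k with k \<ge> 2, so p is at most the square root of N, and 2^k \<le>
  N.\<close>

lemma card_proper_primepows_le:
  assumes "N > 0"
  shows "real (card {n. primepow n \<and> \<not>prime n \<and> n \<le> N}) \<le> (sqrt (real N) + 1) * (log 2 (real N) + 1)"
proof -
  define a b where "a = nat \<lfloor>sqrt (real N)\<rfloor>" and "b = nat \<lfloor>log 2 (real N)\<rfloor>"
  have "{n. primepow n \<and> \<not>prime n \<and> n \<le> N} \<subseteq> (\<lambda>(p, k). p ^ k) ` ({..a} \<times> {..b})"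
  proof
    fix n assume "n \<in> {n. primepow n \<and> \<not>prime n \<and> n \<le> N}"
    hence n: "primepow n" "\<not>prime n" "n \<le> N" by auto
    then obtain p k where pk: "prime p" "k > 0" "n = p ^ k" by (auto simp: primepow_def)
    have "k \<noteq> 1" using pk n by auto
    hence k: "k \<ge> 2" using pk by linarith
    have p: "p \<ge> 2" using pk prime_ge_2_nat by blast
    have "p ^ 2 \<le> p ^ k" using p k by (intro power_increasing) auto
    hence "p ^ 2 \<le> N" using n pk by linarith
    hence "(real p) ^ 2 \<le> real N" by (metis of_nat_le_iff of_nat_power)
    hence "real p \<le> sqrt (real N)" by (rule real_le_rsqrt)
    hence pa: "p \<le> a" by (simp add: a_def le_nat_floor)
    have "2 ^ k \<le> p ^ k" using p by (intro power_mono) auto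
    hence "2 ^ k \<le> N" using n pk by linarith
    hence "(2::real) ^ k \<le> real N" by (metis of_nat_le_iff of_nat_power of_nat_numeral)
    hence "log 2 (2 ^ k) \<le> log 2 (real N)" using assms by (subst log_le_cancel_iff) auto
    hence "real k \<le> log 2 (real N)" by (simp add: log_nat_power)
    hence kb: "k \<le> b" by (simp add: b_def le_nat_floor)
    show "n \<in> (\<lambda>(p, k). p ^ k) ` ({..a} \<times> {..b})" using pa kb pk by auto
  qed
  hence "card {n. primepow n \<and> \<not>prime n \<and> n \<le> N} \<le> card ((\<lambda>(p, k). p ^ k) ` ({..a} \<times> {..b}))"
    by (intro card_mono) auto
  also have "\<dots> \<le> card ({..a} \<times> {..b})" by (rule card_image_le) auto
  also have "\<dots> = (a + 1) * (b + 1)" by (simp add: card_cartesian_product)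
  finally have "real (card {n. primepow n \<and> \<not>prime n \<and> n \<le> N}) \<le> real ((a + 1) * (b + 1))"
    by (simp only: of_nat_le_iff)
  also have "\<dots> = (real a + 1) * (real b + 1)" by (simp add: algebra_simps)
  also have "\<dots> \<le> (sqrt (real N) + 1) * (log 2 (real N) + 1)"
    using assms by (intro mult_mono add_mono) (auto simp: a_def b_def)
  finally show ?thesis .
qed

text \<open>In the sum a prime contributes exactly 1 and a proper prime power between 0 and
  1.\<close>

lemma prime_count_approx:
  assumes "N > 0"
  shows "\<bar>(\<Sum>n=2..N. mangoldt n / ln (real n)) - real (prime_count N)\<bar> \<le> (sqrt (real N) + 1) * (log 2 (real N) + 1)"
proof -
  define A B where "A = {p. prime p \<and> p \<le> N}" and "B = {n. primepow n \<and> \<not>prime n \<and> n \<le> N}"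
  have fin: "finite A" "finite B" by (auto simp: A_def B_def)
  have ge2: "n \<ge> 2" if "n \<in> A \<union> B" for n
    using that prime_ge_2_nat primepow_gt_Suc_0[of n] by (auto simp: A_def B_def)
  have "(\<Sum>n=2..N. mangoldt n / ln (real n)) = (\<Sum>n\<in>A \<union> B. mangoldt n / ln (real n))"
    using ge2 by (intro sum.mono_neutral_right) (auto simp: A_def B_def mangoldt_def)
  also have "\<dots> = (\<Sum>n\<in>A. mangoldt n / ln (real n)) + (\<Sum>n\<in>B. mangoldt n / ln (real n))"
    using fin by (intro sum.union_disjoint) (auto simp: A_def B_def)
  also have "(\<Sum>n\<in>A. mangoldt n / ln (real n)) = (\<Sum>n\<in>A. 1)"
  proof (intro sum.cong refl)
    fix n assume "n \<in> A"
    thus "mangoldt n / ln (real n) = 1" using ge2[of n] by (simp add: A_def)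
  qed
  also have "\<dots> = real (prime_count N)" by (simp add: prime_count_def A_def)
  finally have eq: "(\<Sum>n=2..N. mangoldt n / ln (real n)) - real (prime_count N) = (\<Sum>n\<in>B. mangoldt n / ln (real n))"
    by simp
  have nonneg: "(\<Sum>n\<in>B. mangoldt n / ln (real n)) \<ge> 0"
    using ge2 by (intro sum_nonneg divide_nonneg_nonneg mangoldt_nonneg) force+
  have "(\<Sum>n\<in>B. mangoldt n / ln (real n)) \<le> (\<Sum>n\<in>B. 1)"
  proof (intro sum_mono)
    fix n assume "n \<in> B"
    thus "mangoldt n / ln (real n) \<le> 1" using ge2[of n] mangoldt_le[of n] by (auto simp: divide_simps)
  qed
  also have "\<dots> \<le> (sqrt (real N) + 1) * (log 2 (real N) + 1)"
    using card_proper_primepows_le[OF assms] by (simp add: B_def)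
  finally show ?thesis unfolding eq using nonneg by simp
qed

lemma prime_count_asymp:
  "(\<lambda>N. real (prime_count N) - (real N / ln (real N) + real N / ln (real N) ^ 2)) \<in> O(\<lambda>N. real N / ln (real N) ^ 3)"
proof -
  have "(\<lambda>N. (\<Sum>n=2..N. mangoldt n / ln (real n)) - real (prime_count N)) \<in> O(\<lambda>N. (sqrt (real N) + 1) * (log 2 (real N) + 1))"
  proof (rule bigoI[of _ 1], rule eventually_mono[OF eventually_gt_at_top[of 0]])
    fix N :: nat assume "N > 0"
    from prime_count_approx[OF this]
    show "norm ((\<Sum>n=2..N. mangoldt n / ln (real n)) - real (prime_count N)) \<le> 1 * norm ((sqrt (real N) + 1) * (log 2 (real N) + 1))"
      by simp
  qed
  also have "(\<lambda>N. (sqrt (real N) + 1) * (log 2 (real N) + 1)) \<in> O(\<lambda>N. real N / ln (real N) ^ 3)"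
    by real_asymp
  finally have "(\<lambda>N. (\<Sum>n=2..N. (mangoldt n - 1) / ln (real n)) + 
      ((\<Sum>n=2..N. 1 / ln (real n)) - (real N / ln (real N) + real N / ln (real N) ^ 2)) -
      ((\<Sum>n=2..N. mangoldt n / ln (real n)) - real (prime_count N))) \<in> O(\<lambda>N. real N / ln (real N) ^ 3)"
    by (rule sum_in_bigo(2)[OF sum_in_bigo(1)[OF sum_mangoldt_over_ln_asymp sum_inverse_ln_asymp]])
  thus ?thesis by (simp add: diff_divide_distrib sum_subtractf algebra_simps)
qed

section \<open>The \<open>n\<close>-th prime\<close>

text \<open>\<open>enumerate\<close> starts at 0, so the primes up to \<open>nth_prime n\<close> are
  its values at the n indices below n.\<close>

lemma prime_count_nth_prime:
  assumes "n \<ge> 1"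
  shows   "prime_count (nth_prime n) = n"
proof -
  define e where "e = enumerate {p::nat. prime p}"
  have inf: "infinite {p::nat. prime p}" by (rule primes_infinite)
  have mono: "strict_mono e" unfolding e_def by (rule strict_mono_enumerate[OF inf])
  have "{p. prime p \<and> p \<le> nth_prime n} = e ` {..<n}"
  proof (intro equalityI subsetI)
    fix p assume p: "p \<in> {p. prime p \<and> p \<le> nth_prime n}"
    then obtain m where m: "p = e m"
      using enumerate_Ex[OF inf, of p] by (auto simp: e_def)
    hence "e m \<le> e (n - 1)" using p by (simp add: nth_prime_def e_def)
    hence "m \<le> n - 1" by (simp add: strict_mono_less_eq[OF mono])
    thus "p \<in> e ` {..<n}" using m assms by auto
  next
    fix p assume "p \<in> e ` {..<n}"
    then obtain m where m: "m < n" "p = e m" by auto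
    hence "e m \<le> e (n - 1)" by (simp add: strict_mono_less_eq[OF mono])
    thus "p \<in> {p. prime p \<and> p \<le> nth_prime n}"
      using m enumerate_in_set[OF inf, of m] by (auto simp: e_def nth_prime_def)
  qed
  hence "prime_count (nth_prime n) = card (e ` {..<n})" by (simp add: prime_count_def)
  also have "\<dots> = n" using strict_mono_imp_inj_on[OF mono] by (subst card_image) (auto simp: inj_on_def)
  finally show ?thesis .
qed

lemma filterlim_nth_prime: "filterlim nth_prime at_top at_top"
proof (rule filterlim_at_top_mono)
  show "filterlim (\<lambda>n::nat. n - 1) at_top at_top" by (rule filterlim_minus_const_nat_at_top)
  show "eventually (\<lambda>n. n - 1 \<le> nth_prime n) at_top"
    by (intro always_eventually allI) (simp add: nth_prime_def le_enumerate[OF primes_infinite])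
qed

text \<open>With L = ln N, the product (N/L + N/L^2) (L - 1 + \<epsilon>) is N + \<epsilon> N/L +
  (\<epsilon> - 1) N/L^2: the terms N/L from the two factors cancel, and \<epsilon> N/L exceeds
  everything else. Likewise with -\<epsilon>, where the subtracted 1 costs only O(L).\<close>

lemma prime_count_bounds:
  fixes \<epsilon> :: real
  assumes "\<epsilon> > 0"
  shows   "eventually (\<lambda>N. real (prime_count N) * (ln (real N) - 1 + \<epsilon>) > real N) at_top"
    and   "eventually (\<lambda>N. (real (prime_count N) - 1) * (ln (real N) - 1 - \<epsilon>) < real N) at_top"
proof -
  define r where "r = (\<lambda>N. real (prime_count N) - (real N / ln (real N) + real N / ln (real N) ^ 2))"
  have prod: "(\<lambda>N. r N * (ln (real N) + c)) \<in> o(\<lambda>N. real N / ln (real N))" for c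
  proof -
    have "(\<lambda>N. r N * (ln (real N) + c)) \<in> O(\<lambda>N. real N / ln (real N) ^ 3 * ln (real N))"
      unfolding r_def by (intro landau_o.big.mult prime_count_asymp) real_asymp
    also have "(\<lambda>N. real N / ln (real N) ^ 3 * ln (real N)) \<in> o(\<lambda>N. real N / ln (real N))" by real_asymp
    finally show ?thesis .
  qed
  have small: "eventually (\<lambda>N. \<bar>f N\<bar> \<le> \<epsilon> / 2 * (real N / ln (real N))) at_top"
    if "f \<in> o(\<lambda>N. real N / ln (real N))" for f :: "nat \<Rightarrow> real"
  proof -
    have "eventually (\<lambda>N. norm (f N) \<le> \<epsilon> / 2 * norm (real N / ln (real N))) at_top"
      using assms by (intro landau_o.smallD[OF that]) auto
    moreover have "eventually (\<lambda>N. ln (real N) > 0) at_top" by real_asymp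
    ultimately show ?thesis by eventually_elim simp
  qed
  have "(\<lambda>N. r N * (ln (real N) + (\<epsilon> - 1)) + (\<epsilon> - 1) * (real N / ln (real N) ^ 2)) \<in> o(\<lambda>N. real N / ln (real N))"
    by (intro sum_in_smallo prod) real_asymp
  from small[OF this] have "eventually (\<lambda>N. \<bar>r N * (ln (real N) + (\<epsilon> - 1)) + (\<epsilon> - 1) * (real N / ln (real N) ^ 2)\<bar> \<le> \<epsilon> / 2 * (real N / ln (real N))) at_top" .
  moreover have pos: "eventually (\<lambda>N. ln (real N) > 0) at_top" by real_asymp
  ultimately show "eventually (\<lambda>N. real (prime_count N) * (ln (real N) - 1 + \<epsilon>) > real N) at_top"
    using eventually_gt_at_top[of 0]
  proof eventually_elim
    case (elim N)
    have "real (prime_count N) * (ln (real N) - 1 + \<epsilon>) = real N + \<epsilon> * (real N / ln (real N)) +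
            (r N * (ln (real N) + (\<epsilon> - 1)) + (\<epsilon> - 1) * (real N / ln (real N) ^ 2))"
      using elim by (simp add: r_def divide_simps power2_eq_square) (simp add: algebra_simps)
    moreover have "\<epsilon> * (real N / ln (real N)) > 0" using elim assms by simp
    ultimately show ?case using elim(1) by linarith
  qed
  have "(\<lambda>N. r N * (ln (real N) + (-\<epsilon> - 1)) + ((-\<epsilon> - 1) * (real N / ln (real N) ^ 2) - (ln (real N) - 1 - \<epsilon>))) \<in> o(\<lambda>N. real N / ln (real N))"
    by (rule sum_in_smallo(1)[OF prod]) real_asymp
  from small[OF this] have "eventually (\<lambda>N. \<bar>r N * (ln (real N) + (-\<epsilon> - 1)) + ((-\<epsilon> - 1) * (real N / ln (real N) ^ 2) - (ln (real N) - 1 - \<epsilon>))\<bar> \<le> \<epsilon> / 2 * (real N / ln (real N))) at_top" .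
  thus "eventually (\<lambda>N. (real (prime_count N) - 1) * (ln (real N) - 1 - \<epsilon>) < real N) at_top"
    using eventually_gt_at_top[of 0] pos
  proof eventually_elim
    case (elim N)
    have "(real (prime_count N) - 1) * (ln (real N) - 1 - \<epsilon>) = real N - \<epsilon> * (real N / ln (real N)) +
            (r N * (ln (real N) + (-\<epsilon> - 1)) + ((-\<epsilon> - 1) * (real N / ln (real N) ^ 2) - (ln (real N) - 1 - \<epsilon>)))"
      using elim by (simp add: r_def divide_simps power2_eq_square) (simp add: algebra_simps)
    moreover have "\<epsilon> * (real N / ln (real N)) > 0" using elim assms by simp
    ultimately show ?case using elim(1) by linarith
  qed
qed

text \<open>
  For \<open>w = - lambert_Wm1 (- (exp b / a))\<close> the number \<open>X = a * w\<close> solves \<open>a * (ln X - b) = X\<close>; comparing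
  \<open>X\<close> with \<open>p\<close> therefore amounts to comparing \<open>a * (ln p - b)\<close> with \<open>p\<close>.
\<close>
lemma lambert_Wm1_compare:
  fixes a b p :: real
  assumes "a > 0" "p > 0" "exp (b + 1) \<le> a" "ln p \<ge> b + 1"
  shows   "a * (ln p - b) > p \<Longrightarrow> - a * lambert_Wm1 (- (exp b / a)) > p"
    and   "a * (ln p - b) < p \<Longrightarrow> - a * lambert_Wm1 (- (exp b / a)) < p"
proof -
  define w where "w = - lambert_Wm1 (- (exp b / a))"
  define v where "v = ln p - b"
  have "exp b / a \<le> exp (-1)"
    using assms by (simp add: exp_add exp_minus field_simps)
  from lambert_Wm1[of "- (exp b / a)"] this assms have w: "w \<ge> 1" "w * exp (-w) = exp b / a"
    by (auto simp: w_def)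
  have v: "v \<ge> 1" using assms by (simp add: v_def)
  have p: "p = exp (v + b)" using assms by (simp add: v_def)
  have aw: "a * w = exp (w + b)"
    using w(2) assms(1) by (simp add: exp_minus exp_add field_simps)
  have dec: "y * exp (-y) < x * exp (-x)" if "1 \<le> x" "x < y" for x y :: real
    using x_exp_strict_antimono[of "-y" "-x"] that by simp
  have "exp (-v) = exp b / p" unfolding p by (simp add: exp_minus exp_add field_simps)
  \<comment> \<open>Relative to p, the quantity a v is v exp(-v) times a / exp b, and the same
    scaling turns w exp(-w) into 1. So comparing a v with p is comparing v exp(-v) with w exp(-w),
    and \<open>dec\<close> reverses the order because v and w are at least 1.\<close>
  hence scale: "a * (ln p - b) = v * exp (-v) * (a / exp b) * p"
    using assms by (simp flip: v_def)
  have w_scale: "w * exp (-w) * (a / exp b) = 1" using assms by (simp add: w)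
  have ab: "a / exp b > 0" using assms by simp
  show "p < - a * lambert_Wm1 (- (exp b / a))" if "a * (ln p - b) > p"
  proof -
    have "1 * p < v * exp (-v) * (a / exp b) * p"
      using that unfolding scale by (simp only: mult_1)
    hence "v * exp (-v) * (a / exp b) > w * exp (-w) * (a / exp b)"
      using assms(2) unfolding w_scale by (simp only: mult_less_cancel_right_pos)
    hence "v * exp (-v) > w * exp (-w)" using ab by (simp only: mult_less_cancel_right_pos)
    hence "v < w" using dec[of w v] w v by (cases v w rule: linorder_cases) auto
    hence "p < a * w" unfolding p aw by simp
    thus ?thesis by (simp add: w_def)
  qed
  show "p > - a * lambert_Wm1 (- (exp b / a))" if "a * (ln p - b) < p"
  proof -
    have "v * exp (-v) * (a / exp b) * p < 1 * p"
      using that unfolding scale by (simp only: mult_1)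
    hence "v * exp (-v) * (a / exp b) < w * exp (-w) * (a / exp b)"
      using assms(2) unfolding w_scale by (simp only: mult_less_cancel_right_pos)
    hence "v * exp (-v) < w * exp (-w)" using ab by (simp only: mult_less_cancel_right_pos)
    hence "w < v" using dec[of v w] w v by (cases v w rule: linorder_cases) auto
    hence "a * w < p" unfolding p aw by simp
    thus ?thesis by (simp add: w_def)
  qed
qed

theorem theorem9:
  fixes \<epsilon> :: real
  assumes "\<epsilon> > 0"
  shows "\<exists>M::nat. \<forall>n\<ge>M.
           - real n * lambert_Wm1 (- (exp (1 - \<epsilon>) / real n)) > real (nth_prime n) \<and>
           real (nth_prime n) > - (real n - 1) * lambert_Wm1 (- (exp (1 + \<epsilon>) / (real n - 1)))"
proof -
  have p_large: "eventually (\<lambda>n. P (nth_prime n)) at_top" if "eventually P at_top" for P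
    using that filterlim_nth_prime by (rule eventually_compose_filterlim)
  \<comment> \<open>2 + \<epsilon> is b + 1 for b = 1 + \<epsilon>, the larger of the two values 1 -
    \<epsilon> and 1 + \<epsilon> at which \<open>lambert_Wm1_compare\<close> is used.\<close>
  have "eventually (\<lambda>N. ln (real N) \<ge> 2 + \<epsilon>) at_top" by real_asymp
  from p_large[OF this] p_large[OF prime_count_bounds(1)[OF assms]] p_large[OF prime_count_bounds(2)[OF assms]]
       p_large[OF eventually_gt_at_top[of 0]]
  have "eventually (\<lambda>n. - real n * lambert_Wm1 (- (exp (1 - \<epsilon>) / real n)) > real (nth_prime n) \<and>
           real (nth_prime n) > - (real n - 1) * lambert_Wm1 (- (exp (1 + \<epsilon>) / (real n - 1)))) at_top"
    \<comment> \<open>The added 1 makes n - 1, not only n, at least exp(2 + \<epsilon>), so both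
      arguments of \<open>lambert_Wm1\<close> lie between -1/e and 0.\<close>
    using eventually_ge_at_top[of "nat \<lceil>exp (2 + \<epsilon>)\<rceil> + 1"]
  proof eventually_elim
    case (elim n)
    have n: "real n - 1 \<ge> exp (2 + \<epsilon>)" using elim(5) by linarith
    have n1: "real n - 1 > 0" using n exp_gt_zero[of "2 + \<epsilon>"] by linarith
    have count: "prime_count (nth_prime n) = n" using n1 by (intro prime_count_nth_prime) linarith
    have "exp (1 - \<epsilon> + 1) \<le> exp (2 + \<epsilon>)" using assms by simp
    hence n2: "exp (1 - \<epsilon> + 1) \<le> real n" using n by linarith
    have "real n * (ln (real (nth_prime n)) - (1 - \<epsilon>)) > real (nth_prime n)"
      using elim(2) by (simp add: count algebra_simps)
    moreover have "(real n - 1) * (ln (real (nth_prime n)) - (1 + \<epsilon>)) < real (nth_prime n)"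
      using elim(3) by (simp add: count algebra_simps)
    ultimately show ?case
      using n n1 n2 elim assms
      by (intro conjI lambert_Wm1_compare) (auto simp: add_ac)
  qed
  thus ?thesis by (simp add: eventually_at_top_linorder)
qed

end
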